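(* Let $\theta\in C_0^\infty(\mathbb{R}^n)$ have support in a ball $B$ and satisfy $\int\theta(x)\,dx=1$. For $\ell\in\{1,\dots,n\}$, the operators $R_\ell$ and $T_\ell$ defined on $u\in C_0^\infty(\mathbb{R}^n,\Lambda^\ell)$ by $$R_\ell u(x)=\int G_{n-\ell+1}(y,x)\,(x-y)\lrcorner u(y)\,dy,\qquad T_\ell u(x)=\int G_\ell(x,y)\,(x-y)\lrcorner u(y)\,dy,$$ where $$G_\ell(x,y)=\int_1^\infty (t-1)^{n-\ell}t^{\ell-1}\,\theta\bigl(y+t(x-y)\bigr)\,dt,$$ are pseudodifferential operators on $\mathbb{R}^n$ of order $-1$ with symbols in the Hörmander symbol class $S^{-1}_{1,0}(\mathbb{R}^n)$.
   Context: $\Lambda^\ell$ is the degree-$\ell$ part of the exterior algebra of $\mathbb{R}^n$; $C_0^\infty(\mathbb{R}^n,\Lambda^\ell)$ denotes $\ell$-forms with coefficients in $C_0^\infty(\mathbb{R}^n)$. For a vector $a\in\mathbb{R}^n$, $a\lrcorner$ is contraction: $a\lrcorner(dx_{j_1}\wedge\dots\wedge dx_{j_\ell})=\sum_{k=1}^\ell(-1)^{k-1}a_{j_k}\,dx_{j_1}\wedge\dots\widehat{dx_{j_k}}\dots\wedge dx_{j_\ell}$ for $j_1<\dots<j_\ell$. The integrals defining $R_\ell u$, $T_\ell u$ are weakly singular and convergent. $S^{-1}_{1,0}(\mathbb{R}^n)$ is the local symbol class of functions $a\in C^\infty(\mathbb{R}^n\times\mathbb{R}^n)$ such that for every compact $M\subset\mathbb{R}^n$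 and all multi-indices $\alpha,\beta\in\mathbb{N}_0^n$ there is a constant $C_{\alpha\beta}(M)$ with $|\partial_x^\alpha\partial_\xi^\beta a(x,\xi)|\le C_{\alpha\beta}(M)(1+|\xi|)^{-1-|\beta|}$ for all $(x,\xi)\in M\times\mathbb{R}^n$. As usual, a scalar operator is a pseudodifferential operator of order $-1$ with symbol in this class if, on $C_0^\infty(\mathbb{R}^n)$, it equals $u\mapsto(2\pi)^{-n}\int e^{i\langle\xi,x\rangle}a(x,\xi)\hat u(\xi)\,d\xi$ with $a\in S^{-1}_{1,0}(\mathbb{R}^n)$ up to addition of an integral operator with kernel in $C^\infty(\mathbb{R}^n\times\mathbb{R}^n)$; an operator on differential forms is of this type if all entries of its matrix with respect to the standard bases $dx_{j_1}\wedge\dots\wedge dx_{j_\ell}$ are. *)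

theory Defs
  imports "HOL-Analysis.Analysis"
begin

definition partial ::
    "'a::real_normed_vector \<Rightarrow> ('a \<Rightarrow> 'b::real_normed_vector) \<Rightarrow> 'a \<Rightarrow> 'b" where
  "partial v f x = frechet_derivative f (at x) v"

definition smooth :: "('a::euclidean_space \<Rightarrow> 'b::real_normed_vector) \<Rightarrow> bool" where
  "smooth f \<longleftrightarrow>
     (\<forall>vs. set vs \<subseteq> Basis \<longrightarrow> (\<forall>x. (foldr partial vs f) differentiable (at x)))"
  \<comment> \<open>All iterated partial derivatives exist and are (totally) differentiable, hence continuous:
      this is \<open>C\<^sup>\<infinity>\<close> on the whole space.\<close>

definition multi_partial ::
    "nat^'n::{finite,linorder} \<Rightarrow> (real^'n::{finite,linorder} \<Rightarrow> 'b::real_normed_vector) \<Rightarrow>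
     real^'n::{finite,linorder} \<Rightarrow> 'b" where
  "multi_partial \<alpha> f =
     foldr (\<lambda>i. partial (axis i 1) ^^ (\<alpha> $ i)) (sorted_list_of_set UNIV) f"
  \<comment> \<open>Only applied to smooth functions, where the order of the differentiations is immaterial.\<close>

definition supp :: "('a::topological_space \<Rightarrow> 'b::zero) \<Rightarrow> 'a set" where
  "supp f = closure {x. f x \<noteq> 0}"

definition test_functions :: "('a::euclidean_space \<Rightarrow> complex) set" where
  "test_functions = {f. smooth f \<and> compact (supp f)}"

definition symbol_class ::
    "real \<Rightarrow> (real^'n::{finite,linorder} \<Rightarrow> real^'n::{finite,linorder} \<Rightarrow> complex) set" where
  "symbol_class m =
     {a. smooth (\<lambda>(x, \<xi>). a x \<xi>) \<and>
         (\<forall>M \<alpha> \<beta>. compact M \<longrightarrow>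
           (\<exists>C. \<forall>x\<in>M. \<forall>\<xi>.
              norm (multi_partial \<alpha> (\<lambda>x'. multi_partial \<beta> (a x') \<xi>) x)
                \<le> C * (1 + norm \<xi>) powr (m - real (\<Sum>i\<in>UNIV. \<beta> $ i))))}"

definition fourier :: "('a::euclidean_space \<Rightarrow> complex) \<Rightarrow> 'a \<Rightarrow> complex" where
  "fourier f \<xi> = (LINT x|lborel. exp (- (\<i> * of_real (\<xi> \<bullet> x))) * f x)"

definition symbol_op ::
    "(real^'n \<Rightarrow> real^'n \<Rightarrow> complex) \<Rightarrow> (real^'n \<Rightarrow> complex) \<Rightarrow> real^'n \<Rightarrow> complex" where
  "symbol_op a f x =
     (LINT \<xi>|lborel. exp (\<i> * of_real (\<xi> \<bullet> x)) * a x \<xi> * fourier f \<xi>) / (2 * of_real pi) ^ CARD('n)"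

definition kernel_op ::
    "('a::euclidean_space \<Rightarrow> 'a \<Rightarrow> complex) \<Rightarrow> ('a \<Rightarrow> complex) \<Rightarrow> 'a \<Rightarrow> complex" where
  "kernel_op k f x = (LINT y|lborel. k x y * f y)"

definition pseudodiff_op ::
    "real \<Rightarrow> ((real^'n::{finite,linorder} \<Rightarrow> complex) \<Rightarrow>
       real^'n::{finite,linorder} \<Rightarrow> complex) \<Rightarrow> bool" where
  "pseudodiff_op m P \<longleftrightarrow>
     (\<exists>a\<in>symbol_class m. \<exists>k. smooth (\<lambda>(x, y). k x y) \<and>
        (\<forall>f\<in>test_functions. \<forall>x. P f x = symbol_op a f x + kernel_op k f x))"

text \<open>
  The (complexified) exterior algebra of the space \<open>real^'n\<close> is the space \<open>complex^('n set)\<close>: for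
  \<open>J = {j\<^sub>1 < \<dots> < j\<^sub>l}\<close>, the component \<open>w $ J\<close> is the coefficient of
  \<open>dx\<^sub>j\<^sub>1 \<and> \<dots> \<and> dx\<^sub>j\<^sub>l\<close>. The order on the index type fixes the signs.
\<close>

abbreviation dx :: "'n::finite set \<Rightarrow> complex^('n set)" where
  "dx J \<equiv> axis J 1"

definition contract_dx :: "real^'n::{finite,linorder} \<Rightarrow> 'n set \<Rightarrow> complex^('n set)" where
  "contract_dx v J = (\<Sum>j\<in>J. ((-1) ^ card {i\<in>J. i < j} * of_real (v $ j)) *s dx (J - {j}))"
  \<comment> \<open>If \<open>j\<close> is the \<open>k\<close>-th smallest element of \<open>J\<close>, then \<open>card {i\<in>J. i < j} = k - 1\<close>.\<close>

definition contract ::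
    "real^'n::{finite,linorder} \<Rightarrow> complex^('n set) \<Rightarrow> complex^('n set)" where
  "contract v w = (\<Sum>J\<in>UNIV. (w $ J) *s contract_dx v J)"

definition test_forms :: "nat \<Rightarrow> (real^'n::finite \<Rightarrow> complex^('n set)) set" where
  "test_forms l =
     {u. (\<forall>J. (\<lambda>x. u x $ J) \<in> test_functions) \<and> (\<forall>x J. card J \<noteq> l \<longrightarrow> u x $ J = 0)}"

definition matrix_entry ::
    "((real^'n::finite \<Rightarrow> complex^('n set)) \<Rightarrow> real^'n \<Rightarrow> complex^('n set)) \<Rightarrow>
     'n set \<Rightarrow> 'n set \<Rightarrow> (real^'n \<Rightarrow> complex) \<Rightarrow> real^'n \<Rightarrow> complex" where
  "matrix_entry A K J f x = A (\<lambda>y. f y *s dx J) x $ K"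

definition pseudodiff_form_op ::
    "real \<Rightarrow> nat \<Rightarrow> nat \<Rightarrow>
     ((real^'n::{finite,linorder} \<Rightarrow> complex^('n set)) \<Rightarrow>
       real^'n::{finite,linorder} \<Rightarrow> complex^('n set)) \<Rightarrow> bool" where
  "pseudodiff_form_op m l l' A \<longleftrightarrow>
     (\<forall>u\<in>test_forms l. \<forall>x.
        A u x = (\<Sum>K | card K = l'. \<Sum>J | card J = l.
                   matrix_entry A K J (\<lambda>y. u y $ J) x *s dx K)) \<and>
     (\<forall>K J. card K = l' \<longrightarrow> card J = l \<longrightarrow> pseudodiff_op m (matrix_entry A K J))"
  \<comment> \<open>The first conjunct says that \<open>A\<close> maps \<open>l\<close>-forms to \<open>l'\<close>-forms and is represented by its
      matrix with respect to the standard bases.\<close>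

definition G_kernel ::
    "(real^'n \<Rightarrow> complex) \<Rightarrow> nat \<Rightarrow> real^'n \<Rightarrow> real^'n \<Rightarrow> complex" where
  "G_kernel \<theta> l x y =
     (LINT t:{1..}|lborel. of_real ((t - 1) ^ (CARD('n) - l) * t ^ (l - 1)) * \<theta> (y + t *\<^sub>R (x - y)))"
  \<comment> \<open>For \<open>x \<noteq> y\<close> and \<open>\<theta>\<close> of compact support the integrand has compact support; on the null set
      \<open>x = y\<close> the integral may diverge, and then has the conventional value \<open>0\<close>.\<close>

definition R_op ::
    "(real^'n::{finite,linorder} \<Rightarrow> complex) \<Rightarrow> nat \<Rightarrow>
     (real^'n::{finite,linorder} \<Rightarrow> complex^('n set)) \<Rightarrow>
       real^'n::{finite,linorder} \<Rightarrow> complex^('n set)" where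
  "R_op \<theta> l u x = (LINT y|lborel. G_kernel \<theta> (CARD('n) - l + 1) y x *s contract (x - y) (u y))"

definition T_op ::
    "(real^'n::{finite,linorder} \<Rightarrow> complex) \<Rightarrow> nat \<Rightarrow>
     (real^'n::{finite,linorder} \<Rightarrow> complex^('n set)) \<Rightarrow>
       real^'n::{finite,linorder} \<Rightarrow> complex^('n set)" where
  "T_op \<theta> l u x = (LINT y|lborel. G_kernel \<theta> l x y *s contract (x - y) (u y))"

end

theory Submission
  imports Defs "HOL-Probability.Characteristic_Functions" "HOL-Probability.Sinc_Integral"
begin

text \<open>
  Both operators act on components as \<open>f \<mapsto> \<integral> \<langle>e, x - y\<rangle> G(x, y) f(y) dy\<close> with a fixed vector
  \<open>e\<close>, so everything happens for scalar operators. Put \<open>z = x - y\<close>. With \<open>s = t - 1\<close> the kernel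
  of \<open>T\<^sub>l\<close> becomes \<open>\<langle>e, z\<rangle> \<integral>\<^sub>0\<^sup>\<infinity> s\<^sup>n\<^sup>-\<^sup>l (1 + s)\<^sup>l\<^sup>-\<^sup>1 \<theta>(x + s z) ds\<close>. It is singular at
  \<open>z = 0\<close> only because of large \<open>s\<close>: the part \<open>s \<le> 1\<close> is smooth in \<open>(x, y)\<close> and is the smoothing
  term. On the part \<open>s \<ge> 1\<close> the substitutions \<open>r = 1 / s\<close> and \<open>w = s z\<close> remove the singularity
  altogether (\<open>radial_kernel_integral\<close>) and leave

    \<open>\<integral>\<^sub>0\<^sup>1 p(r) \<integral> H(x, w) f(x - r w) dw dr\<close>, where \<open>H(x, w) = \<langle>e, w\<rangle> \<theta>(x + w)\<close>, \<open>p(r) = (1 + r)\<^sup>l\<^sup>-\<^sup>1\<close>.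

  The kernel of \<open>R\<^sub>l\<close> has the same form from the start, with \<open>\<theta>(x - w)\<close> in place of \<open>\<theta>(x + w)\<close>,
  with \<open>p(r) = (1 - r)\<^sup>l\<^sup>-\<^sup>1\<close>, and without a smoothing term.

  By Fourier inversion this double integral is exactly the operator with symbol
  \<open>a(x, \<xi>) = \<integral>\<^sub>0\<^sup>1 p(r) h(x, r \<xi>) dr\<close>, where \<open>h(x, \<cdot>)\<close> is the Fourier transform of \<open>H(x, \<cdot>)\<close>
  (\<open>symbol_op_radial_symbol\<close>); no cut-off functions and no asymptotic expansions are involved.

  Symbols of this form are stable under differentiation: \<open>\<partial>\<^sub>x\<close> falls on \<open>H\<close>, while \<open>\<partial>\<^sub>\<xi>\<close> multiplies
  \<open>H\<close> by a linear function of \<open>w\<close> and \<open>p\<close> by \<open>r\<close>. Hence all the symbol estimates follow from a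
  single one (\<open>radial_symbol_bound\<close>): if \<open>p(r) = O(r\<^sup>k)\<close> then \<open>a(x, \<xi>) = O((1 + |\<xi>|)\<^sup>-\<^sup>1\<^sup>-\<^sup>k)\<close>
  locally uniformly in \<open>x\<close>, because \<open>h\<close> decays rapidly and
  \<open>\<integral>\<^sub>0\<^sup>1 r\<^sup>k (1 + r |\<xi>|)\<^sup>-\<^sup>k\<^sup>-\<^sup>2 dr = O((1 + |\<xi>|)\<^sup>-\<^sup>1\<^sup>-\<^sup>k)\<close>.
\<close>

text \<open>
  Smoothness quantifies over lists of basis vectors, which does not fit products and compositions:
  their partial derivatives are sums of terms of the same kind. Counting the order of
  differentiation instead gives closure properties by induction on the order. Order \<open>0\<close> may impose
  nothing, since differentiability at order \<open>n + 1\<close> implies continuity at order \<open>n\<close>.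
\<close>

section \<open>Calculus of smooth functions\<close>

primrec differentiable_upto :: "nat \<Rightarrow> ('a::euclidean_space \<Rightarrow> 'b::real_normed_vector) \<Rightarrow> bool" where
  "differentiable_upto 0 f \<longleftrightarrow> True"
| "differentiable_upto (Suc n) f \<longleftrightarrow>
     (\<forall>x. f differentiable (at x)) \<and> (\<forall>b\<in>Basis. differentiable_upto n (partial b f))"

lemma partial_eqI:
  assumes "(f has_derivative f') (at x)"
  shows "partial v f x = f' v"
  unfolding partial_def using frechet_derivative_at[OF assms] by simp

lemma differentiable_has_partial:
  assumes "f differentiable (at x)"
  shows "(f has_derivative (\<lambda>v. partial v f x)) (at x)"
  using assms unfolding partial_def by (simp add: frechet_derivative_works)

lemma partial_sum_Basis:
  fixes f :: "'a::euclidean_space \<Rightarrow> 'b::real_normed_vector"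
  assumes "f differentiable (at x)"
  shows "partial v f x = (\<Sum>b\<in>Basis. (v \<bullet> b) *\<^sub>R partial b f x)"
proof -
  interpret bounded_linear "\<lambda>v. partial v f x"
    using differentiable_has_partial[OF assms] by (rule has_derivative_bounded_linear)
  have "partial v f x = partial (\<Sum>b\<in>Basis. (v \<bullet> b) *\<^sub>R b) f x"
    by (simp add: euclidean_representation)
  then show ?thesis
    by (simp add: sum scaleR)
qed

lemma smooth_iff_differentiable_upto: "smooth f \<longleftrightarrow> (\<forall>n. differentiable_upto n f)"
proof -
  have *: "differentiable_upto n f \<longleftrightarrow>
      (\<forall>vs. set vs \<subseteq> Basis \<longrightarrow> length vs < n \<longrightarrow> (\<forall>x. foldr partial vs f differentiable (at x)))"
      (is "_ \<longleftrightarrow> (\<forall>vs. ?P n vs f)")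
    for n
  proof (induction n arbitrary: f)
    case 0
    then show ?case by simp
  next
    case (Suc n)
    show ?case
    proof
      assume L: "differentiable_upto (Suc n) f"
      show "\<forall>vs. ?P (Suc n) vs f"
      proof
        fix vs
        show "?P (Suc n) vs f"
          using L Suc.IH by (cases vs rule: rev_cases) auto
      qed
    next
      assume R: "\<forall>vs. ?P (Suc n) vs f"
      have "f differentiable (at x)" for x
        using R[rule_format, of "[]" x] by simp
      moreover have "differentiable_upto n (partial b f)" if "b \<in> Basis" for b
        unfolding Suc.IH using R[rule_format, of "_ @ [b]"] that by simp
      ultimately show "differentiable_upto (Suc n) f"
        by simp
    qed
  qed
  show ?thesis
    unfolding * smooth_def by (meson lessI)
qed

lemma differentiable_upto_mono: "differentiable_upto (Suc n) f \<Longrightarrow> differentiable_upto n f"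
proof (induction n arbitrary: f)
  case (Suc n)
  then show ?case using differentiable_upto.simps(2) by blast
qed simp

lemma differentiable_upto_const: "differentiable_upto n (\<lambda>x::'a::euclidean_space. c)"
proof (induction n arbitrary: c)
  case (Suc n)
  have "partial b (\<lambda>x::'a. c) = (\<lambda>x. 0)" for b and c :: 'b
    by (rule ext, rule partial_eqI) (auto intro!: derivative_eq_intros)
  then show ?case using Suc by simp
qed simp

lemma differentiable_upto_linear:
  assumes "bounded_linear L" "differentiable_upto n f"
  shows "differentiable_upto n (\<lambda>x. L (f x))"
  using assms(2)
proof (induction n arbitrary: f)
  case (Suc n)
  have der: "((\<lambda>x. L (f x)) has_derivative (\<lambda>v. L (partial v f x))) (at x)" for x
    using Suc.prems by (intro bounded_linear.has_derivative[OF assms(1)] differentiable_has_partial) simp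
  have "partial b (\<lambda>x. L (f x)) = (\<lambda>x. L (partial b f x))" for b
    by (rule ext, rule partial_eqI) (rule der)
  moreover have "(\<lambda>x. L (f x)) differentiable (at x)" for x
    using der differentiableI by blast
  ultimately show ?case using Suc by simp
qed simp

lemma differentiable_upto_add:
  assumes "differentiable_upto n f" "differentiable_upto n g"
  shows "differentiable_upto n (\<lambda>x. f x + g x)"
  using assms
proof (induction n arbitrary: f g)
  case (Suc n)
  have "partial b (\<lambda>x. f x + g x) = (\<lambda>x. partial b f x + partial b g x)" for b
    using Suc.prems
    by (intro ext partial_eqI has_derivative_add differentiable_has_partial) auto
  then show ?case using Suc by simp
qed simp

lemma differentiable_upto_sum:
  assumes "\<And>i. i \<in> I \<Longrightarrow> differentiable_upto n (f i)"
  shows "differentiable_upto n (\<lambda>x. \<Sum>i\<in>I. f i x)"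
  using assms
  by (induction I rule: infinite_finite_induct)
     (auto intro: differentiable_upto_const differentiable_upto_add)

lemma differentiable_upto_bilinear:
  assumes "bounded_bilinear B" "differentiable_upto n f" "differentiable_upto n g"
  shows "differentiable_upto n (\<lambda>x. B (f x) (g x))"
  using assms(2,3)
proof (induction n arbitrary: f g)
  case (Suc n)
  have der: "((\<lambda>x. B (f x) (g x)) has_derivative
      (\<lambda>v. B (f x) (partial v g x) + B (partial v f x) (g x))) (at x)" for x
    using Suc.prems
    by (intro bounded_bilinear.FDERIV[OF assms(1)] differentiable_has_partial) auto
  have "partial b (\<lambda>x. B (f x) (g x)) = (\<lambda>x. B (f x) (partial b g x) + B (partial b f x) (g x))" for b
    by (rule ext, rule partial_eqI) (rule der)
  moreover have "(\<lambda>x. B (f x) (g x)) differentiable (at x)" for x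
    using der differentiableI by blast
  ultimately show ?case
    using Suc.IH Suc.prems differentiable_upto_mono[OF Suc.prems(1)] differentiable_upto_mono[OF Suc.prems(2)]
    by (simp add: differentiable_upto_add)
qed simp

text \<open>
  The chain rule expresses \<open>\<partial>\<^sub>b (f \<circ> g)\<close> by the functions \<open>\<partial>\<^sub>c f \<circ> g\<close> and \<open>\<partial>\<^sub>b g\<close>; to the former
  the induction hypothesis applies, which therefore has to hold for all outer functions.
\<close>

lemma differentiable_upto_compose:
  fixes f :: "'b::euclidean_space \<Rightarrow> 'c::real_normed_vector" and g :: "'a::euclidean_space \<Rightarrow> 'b"
  assumes "differentiable_upto n f" "differentiable_upto n g"
  shows "differentiable_upto n (\<lambda>x. f (g x))"
  using assms
proof (induction n arbitrary: f g)
  case (Suc n)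
  have der: "((\<lambda>x. f (g x)) has_derivative (\<lambda>v. partial (partial v g x) f (g x))) (at x)" for x
    using Suc.prems by (intro has_derivative_compose[of g _ x UNIV f] differentiable_has_partial) auto
  have "partial b (\<lambda>x. f (g x)) = (\<lambda>x. \<Sum>c\<in>Basis. (partial b g x \<bullet> c) *\<^sub>R partial c f (g x))" for b
    using Suc.prems by (intro ext) (simp add: partial_eqI[OF der] partial_sum_Basis[of f])
  moreover have "(\<lambda>x. f (g x)) differentiable (at x)" for x
    using der differentiableI by blast
  moreover have "differentiable_upto n (\<lambda>x. \<Sum>c\<in>Basis. (partial b g x \<bullet> c) *\<^sub>R partial c f (g x))"
    if "b \<in> Basis" for b
    using Suc.prems that differentiable_upto_mono[OF Suc.prems(2)]
    by (intro differentiable_upto_sum differentiable_upto_bilinear[OF bounded_bilinear_scaleR] Suc.IH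
          differentiable_upto_linear[OF bounded_linear_inner_left]) auto
  ultimately show ?case by simp
qed simp

text \<open>
  For functions given by integrals, the partial derivatives are again integrals of the same type;
  then smoothness holds because the whole type is stable under differentiation.
\<close>

lemma smooth_coinduct:
  assumes "f \<in> S" "\<And>f x. f \<in> S \<Longrightarrow> f differentiable (at x)"
    "\<And>f b. f \<in> S \<Longrightarrow> b \<in> Basis \<Longrightarrow> partial b f \<in> S"
  shows "smooth f"
proof -
  have "differentiable_upto n f" for n
    using assms(1) by (induction n arbitrary: f) (auto simp: assms(2,3))
  then show ?thesis
    by (simp add: smooth_iff_differentiable_upto)
qed

lemma smooth_const: "smooth (\<lambda>x. c)"
  by (simp add: smooth_iff_differentiable_upto differentiable_upto_const)

lemma smooth_add: "smooth f \<Longrightarrow> smooth g \<Longrightarrow> smooth (\<lambda>x. f x + g x)"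
  by (simp add: smooth_iff_differentiable_upto differentiable_upto_add)

lemma smooth_bilinear:
  "bounded_bilinear B \<Longrightarrow> smooth f \<Longrightarrow> smooth g \<Longrightarrow> smooth (\<lambda>x. B (f x) (g x))"
  by (simp add: smooth_iff_differentiable_upto differentiable_upto_bilinear)

lemmas smooth_mult = smooth_bilinear[OF bounded_bilinear_mult]
lemmas smooth_scaleR = smooth_bilinear[OF bounded_bilinear_scaleR]
lemmas smooth_inner = smooth_bilinear[OF bounded_bilinear_inner]

lemma smooth_linear: "bounded_linear L \<Longrightarrow> smooth f \<Longrightarrow> smooth (\<lambda>x. L (f x))"
  by (simp add: smooth_iff_differentiable_upto differentiable_upto_linear)

lemmas smooth_of_real = smooth_linear[OF bounded_linear_of_real]
lemmas smooth_fst = smooth_linear[OF bounded_linear_fst]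
lemmas smooth_snd = smooth_linear[OF bounded_linear_snd]

lemma smooth_minus: "smooth f \<Longrightarrow> smooth (\<lambda>x. - f x)"
  by (rule smooth_linear[OF bounded_linear_minus[OF bounded_linear_ident]])

lemma smooth_diff: "smooth f \<Longrightarrow> smooth g \<Longrightarrow> smooth (\<lambda>x. f x - g x)"
  using smooth_add[OF _ smooth_minus] by auto

lemma smooth_id: "smooth (\<lambda>x. x)"
proof -
  have *: "partial b (\<lambda>x::'a. x) = (\<lambda>x. b)" for b
    by (rule ext, rule partial_eqI) (auto intro!: derivative_eq_intros)
  have "differentiable_upto n (\<lambda>x::'a. x)" for n
    by (cases n) (auto simp: * differentiable_upto_const)
  then show ?thesis
    by (simp add: smooth_iff_differentiable_upto)
qed

lemma smooth_compose:
  fixes f :: "'b::euclidean_space \<Rightarrow> 'c::real_normed_vector" and g :: "'a::euclidean_space \<Rightarrow> 'b"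
  shows "smooth f \<Longrightarrow> smooth g \<Longrightarrow> smooth (\<lambda>x. f (g x))"
  by (simp add: smooth_iff_differentiable_upto differentiable_upto_compose)

lemma smooth_Pair: "smooth f \<Longrightarrow> smooth g \<Longrightarrow> smooth (\<lambda>x. (f x, g x))"
proof -
  assume fg: "smooth f" "smooth g"
  have "bounded_linear (\<lambda>y. (y, 0))" "bounded_linear (\<lambda>z. (0, z))"
    by (auto intro!: bounded_linear_intros)
  from smooth_add[OF smooth_linear[OF this(1) fg(1)] smooth_linear[OF this(2) fg(2)]]
  show ?thesis by simp
qed

lemma smooth_power:
  fixes f :: "'a::euclidean_space \<Rightarrow> 'b::real_normed_field"
  shows "smooth f \<Longrightarrow> smooth (\<lambda>x. f x ^ n)"
  by (induction n) (auto intro: smooth_const smooth_mult)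

lemma smooth_exp: "smooth (f :: 'a::euclidean_space \<Rightarrow> complex) \<Longrightarrow> smooth (\<lambda>x. exp (f x))"
proof -
  have *: "partial b exp = (\<lambda>z::complex. exp z * b)" for b
    by (rule ext, rule partial_eqI)
       (metis DERIV_exp has_field_derivative_def)
  have "differentiable_upto n (exp :: complex \<Rightarrow> complex)" for n
  proof (induction n)
    case (Suc n)
    have "exp differentiable (at z)" for z :: complex
      using DERIV_exp differentiableI has_field_derivative_def by blast
    with Suc show ?case
      by (simp add: * differentiable_upto_bilinear[OF bounded_bilinear_mult] differentiable_upto_const)
  qed simp
  moreover assume "smooth f"
  ultimately show ?thesis
    using differentiable_upto_compose[of _ exp f] by (simp add: smooth_iff_differentiable_upto)
qed

lemma smooth_differentiable: "smooth f \<Longrightarrow> f differentiable (at x)"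
  unfolding smooth_def by (metis empty_set empty_subsetI foldr_Nil id_apply)

lemma smooth_has_derivative: "smooth f \<Longrightarrow> (f has_derivative (\<lambda>v. partial v f x)) (at x)"
  by (rule differentiable_has_partial[OF smooth_differentiable])

lemma smooth_continuous_on: "smooth f \<Longrightarrow> continuous_on A f"
  by (meson continuous_at_imp_continuous_on differentiable_imp_continuous_within smooth_differentiable)

lemma smooth_measurable: "smooth f \<Longrightarrow> f \<in> borel_measurable borel"
  by (intro borel_measurable_continuous_onI smooth_continuous_on)

lemma smooth_partial: "smooth f \<Longrightarrow> smooth (partial v f)"
proof -
  assume f: "smooth f"
  have "smooth (partial b f)" if "b \<in> Basis" for b
    using f that unfolding smooth_iff_differentiable_upto
    by (metis differentiable_upto.simps(2))
  then have "smooth (\<lambda>x. \<Sum>b\<in>Basis. (v \<bullet> b) *\<^sub>R partial b f x)"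
    unfolding smooth_iff_differentiable_upto
    by (auto intro!: differentiable_upto_sum differentiable_upto_linear[OF bounded_linear_scaleR_right])
  moreover have "partial v f = (\<lambda>x. \<Sum>b\<in>Basis. (v \<bullet> b) *\<^sub>R partial b f x)"
    by (rule ext, rule partial_sum_Basis[OF smooth_differentiable[OF f]])
  ultimately show ?thesis by simp
qed

lemmas smooth_intros = smooth_const smooth_id smooth_add smooth_diff smooth_minus smooth_mult
  smooth_scaleR smooth_inner smooth_of_real smooth_fst smooth_snd smooth_Pair smooth_power smooth_exp

lemma smooth_slice:
  assumes "smooth f"
  shows "smooth (\<lambda>x. f (x, y))" "smooth (\<lambda>y. f (x, y))"
  by (intro smooth_compose[OF assms] smooth_intros)+

text \<open>
  These equations translate between the partial derivatives of a function on a product and those of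
  its restrictions to slices, in terms of which the symbol estimates are stated.
\<close>

lemma partial_slice:
  assumes "smooth f"
  shows "partial v (\<lambda>x. f (x, y)) x = partial (v, 0) f (x, y)"
    and "partial w (\<lambda>y. f (x, y)) y = partial (0, w) f (x, y)"
proof -
  have "((\<lambda>x. f (x, y)) has_derivative (\<lambda>v. partial (v, 0) f (x, y))) (at x)"
    by (rule has_derivative_compose[OF _ smooth_has_derivative[OF assms]])
       (auto intro!: derivative_eq_intros)
  then show "partial v (\<lambda>x. f (x, y)) x = partial (v, 0) f (x, y)"
    by (rule partial_eqI)
  have "((\<lambda>y. f (x, y)) has_derivative (\<lambda>v. partial (0, v) f (x, y))) (at y)"
    by (rule has_derivative_compose[OF _ smooth_has_derivative[OF assms]])
       (auto intro!: derivative_eq_intros)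
  then show "partial w (\<lambda>y. f (x, y)) y = partial (0, w) f (x, y)"
    by (rule partial_eqI)
qed

lemma partial_fst_eqI:
  assumes "smooth f" "((\<lambda>x. f (x, y)) has_derivative D) (at x)"
  shows "partial (v, 0) f (x, y) = D v"
  by (rule trans[OF partial_slice(1)[OF assms(1), symmetric] partial_eqI[OF assms(2)]])

section \<open>Smooth dependence of integrals on parameters\<close>

text \<open>
  The derivative with respect to the parameter is continuous as a function into the bounded linear
  maps, since all its components are continuous; this is what the Leibniz rule requires.
\<close>

lemma has_derivative_integral_cbox:
  fixes \<Phi> :: "'a::euclidean_space \<times> 'b::euclidean_space \<Rightarrow> 'c::euclidean_space"
  assumes "smooth \<Phi>"
  shows "((\<lambda>p. integral (cbox a b) (\<lambda>t. \<Phi> (p, t))) has_derivative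
          (\<lambda>h. integral (cbox a b) (\<lambda>t. partial (h, 0) \<Phi> (p, t)))) (at p)"
proof -
  let ?D = "\<lambda>z. Blinfun (\<lambda>h. partial (h, 0) \<Phi> z)"
  have der: "((\<lambda>p. \<Phi> (p, t)) has_derivative (\<lambda>h. partial (h, 0) \<Phi> (p, t))) (at p)" for p t
    by (rule has_derivative_compose[OF _ smooth_has_derivative[OF assms]])
       (auto intro!: derivative_eq_intros)
  have app: "blinfun_apply (?D z) = (\<lambda>h. partial (h, 0) \<Phi> z)" for z
    using has_derivative_bounded_linear[OF der[of "snd z" "fst z"]]
    by (simp add: bounded_linear_Blinfun_apply)
  have cont: "continuous_on A ?D" for A
    by (rule continuous_on_blinfun_componentwise)
       (simp add: app smooth_continuous_on[OF smooth_partial[OF assms]])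
  have "continuous_on (cbox a b) (\<lambda>t. \<Phi> (q, t))" for q
    by (intro smooth_continuous_on smooth_slice assms)
  then have "((\<lambda>p. integral (cbox a b) (\<lambda>t. \<Phi> (p, t))) has_derivative
          blinfun_apply (integral (cbox a b) (\<lambda>t. ?D (p, t)))) (at p within UNIV)"
    by (intro leibniz_rule[where fx = "\<lambda>p t. ?D (p, t)"])
       (auto simp: app der cont case_prod_unfold intro: integrable_continuous)
  moreover have "continuous_on (cbox a b) (\<lambda>t. ?D (p, t))"
    by (rule continuous_on_compose2[OF cont[of UNIV]]) (auto intro!: continuous_on_Pair continuous_on_const continuous_on_id)
  then have "blinfun_apply (integral (cbox a b) (\<lambda>t. ?D (p, t))) h =
      integral (cbox a b) (\<lambda>t. partial (h, 0) \<Phi> (p, t))" for h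
    by (subst blinfun_apply_integral) (auto simp: app intro: integrable_continuous)
  then have "blinfun_apply (integral (cbox a b) (\<lambda>t. ?D (p, t))) =
      (\<lambda>h. integral (cbox a b) (\<lambda>t. partial (h, 0) \<Phi> (p, t)))"
    by blast
  ultimately show ?thesis
    by simp
qed

lemma smooth_integral_cbox:
  fixes \<Phi> :: "'a::euclidean_space \<times> 'b::euclidean_space \<Rightarrow> 'c::euclidean_space"
  assumes "smooth \<Phi>"
  shows "smooth (\<lambda>p. integral (cbox a b) (\<lambda>t. \<Phi> (p, t)))"
proof (rule smooth_coinduct[where S = "{\<lambda>p. integral (cbox a b) (\<lambda>t. \<Phi> (p, t)) | \<Phi>. smooth \<Phi>}"])
  show "(\<lambda>p. integral (cbox a b) (\<lambda>t. \<Phi> (p, t))) \<in> {\<lambda>p. integral (cbox a b) (\<lambda>t. \<Phi> (p, t)) | \<Phi>. smooth \<Phi>}"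
    using assms by auto
next
  fix f :: "'a \<Rightarrow> 'c" and x
  assume "f \<in> {\<lambda>p. integral (cbox a b) (\<lambda>t. \<Phi> (p, t)) | \<Phi>. smooth \<Phi>}"
  then show "f differentiable (at x)"
    using has_derivative_integral_cbox differentiableI by blast
next
  fix f :: "'a \<Rightarrow> 'c" and v :: 'a
  assume "f \<in> {\<lambda>p. integral (cbox a b) (\<lambda>t. \<Phi> (p, t)) | \<Phi>. smooth \<Phi>}"
  then obtain \<Phi> where \<Phi>: "smooth \<Phi>" "f = (\<lambda>p. integral (cbox a b) (\<lambda>t. \<Phi> (p, t)))"
    by blast
  have "partial v f = (\<lambda>p. integral (cbox a b) (\<lambda>t. partial (v, 0) \<Phi> (p, t)))"
    unfolding \<Phi>(2) by (rule ext, rule partial_eqI[OF has_derivative_integral_cbox[OF \<Phi>(1)]])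
  then show "partial v f \<in> {\<lambda>p. integral (cbox a b) (\<lambda>t. \<Phi> (p, t)) | \<Phi>. smooth \<Phi>}"
    using smooth_partial[OF \<Phi>(1)] by blast
qed

lemma set_lebesgue_integral_cbox:
  fixes g :: "'a::euclidean_space \<Rightarrow> 'b::euclidean_space"
  assumes "continuous_on (cbox a b) g"
  shows "set_integrable lborel (cbox a b) g"
    and "(LINT t:cbox a b|lborel. g t) = integral (cbox a b) g"
proof -
  show "set_integrable lborel (cbox a b) g"
    unfolding set_integrable_def using assms by (intro borel_integrable_compact) auto
  then show "(LINT t:cbox a b|lborel. g t) = integral (cbox a b) g"
    by (rule set_borel_integral_eq_integral)
qed

lemma integral_compactly_supported:
  fixes g :: "'a::euclidean_space \<Rightarrow> 'b::euclidean_space"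
  assumes "continuous_on UNIV g" "\<And>t. t \<notin> cbox a b \<Longrightarrow> g t = 0"
  shows "integrable lborel g" "integral\<^sup>L lborel g = integral (cbox a b) g"
proof -
  have g: "(\<lambda>t. indicator (cbox a b) t *\<^sub>R g t) = g"
    using assms(2) by (auto simp: indicator_def)
  have "continuous_on (cbox a b) g"
    using assms(1) continuous_on_subset by blast
  from set_lebesgue_integral_cbox[OF this]
  show "integrable lborel g" "integral\<^sup>L lborel g = integral (cbox a b) g"
    by (simp_all add: set_integrable_def set_lebesgue_integral_def g)
qed

text \<open>
  A function of a parameter and an integration variable whose support in the second is bounded,
  locally uniformly in the first. For parameters near a given one, the integral over the whole space
  is then an integral over a fixed box.
\<close>

definition properly_supported ::
    "('a::real_normed_vector \<times> 'b::real_normed_vector \<Rightarrow> 'c::zero) \<Rightarrow> bool" where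
  "properly_supported \<Phi> \<longleftrightarrow>
     (\<forall>R. \<exists>R'. \<forall>p t. norm p \<le> R \<longrightarrow> R' < norm t \<longrightarrow> \<Phi> (p, t) = 0)"

lemma properly_supportedE:
  fixes \<Phi> :: "'a::real_normed_vector \<times> 'b::euclidean_space \<Rightarrow> 'c::zero"
  assumes "properly_supported \<Phi>"
  obtains a where "\<And>p t. norm p \<le> R \<Longrightarrow> t \<notin> cbox (- a) a \<Longrightarrow> \<Phi> (p, t) = 0"
proof -
  obtain R' where R': "\<And>p t. norm p \<le> R \<Longrightarrow> R' < norm t \<Longrightarrow> \<Phi> (p, t) = 0"
    using assms unfolding properly_supported_def by blast
  obtain a :: 'b where "cball 0 R' \<subseteq> cbox (- a) a"
    using bounded_subset_cbox_symmetric[OF bounded_cball] by blast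
  then have "\<Phi> (p, t) = 0" if "norm p \<le> R" "t \<notin> cbox (- a) a" for p t
    using R' that by (metis mem_cball_0 not_le subsetD)
  then show thesis using that by blast
qed

text \<open>
  Vanishing at all \<open>(p, t)\<close> with \<open>|p| \<le> R + 1\<close> and \<open>|t| > R'\<close> includes vanishing near every point
  with \<open>|p| \<le> R\<close> and \<open>|t| > R'\<close>, where all derivatives are therefore zero.
\<close>

lemma properly_supported_partial:
  fixes \<Phi> :: "'a::real_normed_vector \<times> 'b::real_normed_vector \<Rightarrow> 'c::real_normed_vector"
  assumes "properly_supported \<Phi>"
  shows "properly_supported (partial v \<Phi>)"
  unfolding properly_supported_def
proof
  fix R
  obtain R' where R': "\<And>p t. norm p \<le> R + 1 \<Longrightarrow> R' < norm t \<Longrightarrow> \<Phi> (p, t) = 0"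
    using assms unfolding properly_supported_def by blast
  have "partial v \<Phi> (p, t) = 0" if "norm p \<le> R" "R' < norm t" for p t
  proof -
    have "open {(p, t). norm p < R + 1 \<and> R' < norm (t :: 'b)}"
      unfolding case_prod_unfold by (intro open_Collect_conj open_Collect_less continuous_intros)
    then have "(\<Phi> has_derivative (\<lambda>_. 0)) (at (p, t))"
      by (rule has_derivative_transform_within_open[OF has_derivative_const[of 0]])
         (use that R' in \<open>auto simp: less_imp_le\<close>)
    then show ?thesis
      by (rule partial_eqI)
  qed
  then show "\<exists>R'. \<forall>p t. norm p \<le> R \<longrightarrow> R' < norm t \<longrightarrow> partial v \<Phi> (p, t) = 0"
    by blast
qed

lemma properly_supported_mult:
  fixes f g :: "_ \<Rightarrow> 'c::mult_zero"
  assumes "properly_supported g"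
  shows "properly_supported (\<lambda>x. f x * g x)"
  using assms unfolding properly_supported_def by fastforce

lemma has_derivative_integral_properly_supported:
  fixes \<Phi> :: "'a::euclidean_space \<times> 'b::euclidean_space \<Rightarrow> 'c::euclidean_space"
  assumes "smooth \<Phi>" "properly_supported \<Phi>"
  shows "((\<lambda>p. LINT t|lborel. \<Phi> (p, t)) has_derivative
          (\<lambda>h. LINT t|lborel. partial (h, 0) \<Phi> (p, t))) (at p)"
proof -
  obtain a where a: "\<And>q t. norm q \<le> norm p + 1 \<Longrightarrow> t \<notin> cbox (- a) a \<Longrightarrow> \<Phi> (q, t) = 0"
    using properly_supportedE[OF assms(2)] by blast
  have eq: "integral (cbox (- a) a) (\<lambda>t. \<Phi> (q, t)) = (LINT t|lborel. \<Phi> (q, t))"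
    if "q \<in> ball p 1" for q
  proof -
    have "norm q \<le> norm p + 1"
      using that norm_triangle_sub[of q p] by (simp add: dist_norm norm_minus_commute)
    then show ?thesis
      using a by (intro integral_compactly_supported(2)[symmetric] smooth_continuous_on smooth_slice assms(1)) auto
  qed
  have "(LINT t|lborel. partial (h, 0) \<Phi> (p, t)) =
      integral (cbox (- a) a) (\<lambda>t. partial (h, 0) \<Phi> (p, t))" for h
  proof (intro integral_compactly_supported(2) smooth_continuous_on smooth_slice smooth_partial assms(1))
    fix t assume t: "t \<notin> cbox (- a) a"
    have "\<Phi> (q, t) = 0" if "q \<in> ball p 1" for q
      using that norm_triangle_sub[of q p] by (intro a t) (simp add: dist_norm norm_minus_commute)
    then have "((\<lambda>q. \<Phi> (q, t)) has_derivative (\<lambda>_. 0)) (at p)"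
      by (intro has_derivative_transform_within_open[OF has_derivative_const[of 0] open_ball[of p 1]]) auto
    then show "partial (h, 0) \<Phi> (p, t) = 0"
      by (metis partial_slice(1)[OF assms(1)] partial_eqI)
  qed
  moreover have "((\<lambda>p. LINT t|lborel. \<Phi> (p, t)) has_derivative
      (\<lambda>h. integral (cbox (- a) a) (\<lambda>t. partial (h, 0) \<Phi> (p, t)))) (at p)"
    by (rule has_derivative_transform_within_open[OF has_derivative_integral_cbox[OF assms(1)] open_ball[of p 1]])
       (auto simp: eq)
  ultimately show ?thesis
    by simp
qed

lemma partial_integral_properly_supported:
  fixes \<Phi> :: "'a::euclidean_space \<times> 'b::euclidean_space \<Rightarrow> 'c::euclidean_space"
  assumes "smooth \<Phi>" "properly_supported \<Phi>"
  shows "partial v (\<lambda>p. LINT t|lborel. \<Phi> (p, t)) = (\<lambda>p. LINT t|lborel. partial (v, 0) \<Phi> (p, t))"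
  by (rule ext, rule partial_eqI[OF has_derivative_integral_properly_supported[OF assms]])

lemma smooth_integral_properly_supported:
  fixes \<Phi> :: "'a::euclidean_space \<times> 'b::euclidean_space \<Rightarrow> 'c::euclidean_space"
  assumes "smooth \<Phi>" "properly_supported \<Phi>"
  shows "smooth (\<lambda>p. LINT t|lborel. \<Phi> (p, t))"
proof -
  let ?S = "{\<lambda>p. LINT t|lborel. \<Phi> (p, t) | \<Phi> :: 'a \<times> 'b \<Rightarrow> 'c. smooth \<Phi> \<and> properly_supported \<Phi>}"
  show ?thesis
  proof (rule smooth_coinduct[where S = ?S])
    show "(\<lambda>p. LINT t|lborel. \<Phi> (p, t)) \<in> ?S"
      using assms by auto
  next
    fix f x assume "f \<in> ?S"
    then show "f differentiable (at x)"
      using has_derivative_integral_properly_supported differentiableI by blast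
  next
    fix f and v :: 'a assume "f \<in> ?S"
    then obtain \<Phi> :: "'a \<times> 'b \<Rightarrow> 'c" where \<Phi>: "smooth \<Phi>" "properly_supported \<Phi>" "f = (\<lambda>p. LINT t|lborel. \<Phi> (p, t))"
      by blast
    show "partial v f \<in> ?S"
      unfolding \<Phi>(3) partial_integral_properly_supported[OF \<Phi>(1,2)]
      using smooth_partial[OF \<Phi>(1)] properly_supported_partial[OF \<Phi>(2)] by blast
  qed
qed

text \<open>
  Since the affine map is invertible, both directions of the equivalence are instances of one
  implication. It makes the change of variables below valid for functions that are not integrable
  as well: then both integrals have the conventional value \<open>0\<close>.
\<close>

section \<open>Lebesgue integrals over Euclidean spaces\<close>

lemma integrable_affine:
  fixes f :: "'a::euclidean_space \<Rightarrow> 'b::{banach, second_countable_topology}"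
  assumes c: "c \<noteq> 0"
  shows "integrable lborel (\<lambda>x. f (t + c *\<^sub>R x)) \<longleftrightarrow> integrable lborel f"
proof -
  have *: "integrable lborel (\<lambda>x. f (t + c *\<^sub>R x))"
    if f[measurable]: "integrable lborel f" and c: "c \<noteq> 0"
    for f :: "'a \<Rightarrow> 'b" and c :: real and t
  proof -
    have "integrable (density (distr lborel borel (\<lambda>x. t + c *\<^sub>R x)) (\<lambda>_. ennreal (\<bar>c\<bar> ^ DIM('a)))) f"
      using f lborel_affine[OF c, of t] by (simp add: ennreal_power)
    then have "integrable (distr lborel borel (\<lambda>x. t + c *\<^sub>R x)) (\<lambda>x. (\<bar>c\<bar> ^ DIM('a)) *\<^sub>R f x)"
      by (subst (asm) integrable_density) auto
    then have "integrable (distr lborel borel (\<lambda>x. t + c *\<^sub>R x))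
        (\<lambda>x. inverse (\<bar>c\<bar> ^ DIM('a)) *\<^sub>R (\<bar>c\<bar> ^ DIM('a)) *\<^sub>R f x)"
      by (rule integrable_scaleR_right)
    then have "integrable (distr lborel borel (\<lambda>x. t + c *\<^sub>R x)) f"
      using c by simp
    then show ?thesis
      by (subst (asm) integrable_distr_eq) auto
  qed
  have "f = (\<lambda>x. f (t + c *\<^sub>R ((- (1 / c)) *\<^sub>R t + (1 / c) *\<^sub>R x)))"
    using c by (simp add: algebra_simps)
  then show ?thesis
    using *[of f c t] *[of "\<lambda>x. f (t + c *\<^sub>R x)" "1 / c" "(- (1 / c)) *\<^sub>R t"] c by auto
qed

lemma integral_affine:
  fixes f :: "'a::euclidean_space \<Rightarrow> 'b::{banach, second_countable_topology}"
  assumes c: "c \<noteq> 0"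
  shows "(LINT x|lborel. f x) = \<bar>c\<bar> ^ DIM('a) *\<^sub>R (LINT x|lborel. f (t + c *\<^sub>R x))"
proof (cases "integrable lborel f")
  case f[measurable]: True
  have "(LINT x|lborel. f x) =
      (LINT x|density (distr lborel borel (\<lambda>x. t + c *\<^sub>R x)) (\<lambda>_. ennreal (\<bar>c\<bar> ^ DIM('a))). f x)"
    using lborel_affine[OF c, of t] by (simp add: ennreal_power)
  also have "\<dots> = (LINT x|distr lborel borel (\<lambda>x. t + c *\<^sub>R x). (\<bar>c\<bar> ^ DIM('a)) *\<^sub>R f x)"
    by (subst integral_density) auto
  also have "\<dots> = \<bar>c\<bar> ^ DIM('a) *\<^sub>R (LINT x|lborel. f (t + c *\<^sub>R x))"
    by (subst integral_distr) auto
  finally show ?thesis .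
next
  case False
  then show ?thesis
    using integrable_affine[OF c, of f t] by (simp add: not_integrable_integral_eq)
qed

text \<open>
  This covers the interchanges of integrals below in which the integrand splits into a bounded
  factor that couples the two variables, such as a plane wave, and integrable functions of one
  variable each.
\<close>

lemma integrable_bounded_product:
  fixes w :: "'a::euclidean_space \<Rightarrow> 'b::euclidean_space \<Rightarrow> complex"
  assumes w: "(\<lambda>(x, y). w x y) \<in> borel_measurable borel" "\<And>x y. norm (w x y) \<le> B"
    and f: "integrable lborel f" and g: "integrable lborel g"
  shows "integrable (lborel \<Otimes>\<^sub>M lborel) (\<lambda>(x, y). w x y * f x * g y)"
proof (rule lborel_pair.Fubini_integrable)
  have [measurable]: "(\<lambda>z. w (fst z) (snd z)) \<in> borel_measurable (borel \<Otimes>\<^sub>M borel)"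
    using w(1) by (simp add: borel_prod case_prod_unfold)
  have [measurable]: "w x \<in> borel_measurable borel" for x
    using measurable_compose[OF measurable_Pair1' w(1)[folded borel_prod], of x] by simp
  have [measurable]: "f \<in> borel_measurable borel" "g \<in> borel_measurable borel"
    using f g by (simp_all add: borel_measurable_integrable)
  have B: "B \<ge> 0"
    using w(2) norm_ge_zero order_trans by blast
  have le: "norm (w x y * f x * g y) \<le> B * norm (f x) * norm (g y)" for x y
    by (simp add: norm_mult mult_right_mono w(2))
  show "(\<lambda>(x, y). w x y * f x * g y) \<in> borel_measurable (lborel \<Otimes>\<^sub>M lborel)"
    by (simp add: case_prod_unfold)
  have ig: "integrable lborel (\<lambda>y. B * norm (f x) * norm (g y))" for x
    using g by simp
  have i: "integrable lborel (\<lambda>y. w x y * f x * g y)" for x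
    by (rule Bochner_Integration.integrable_bound[OF ig[of x]])
       (use le B in \<open>auto intro: order_trans[OF _ abs_ge_self]\<close>)
  then show "AE x in lborel. integrable lborel (\<lambda>y. case (x, y) of (x, y) \<Rightarrow> w x y * f x * g y)"
    by simp
  show "integrable lborel (\<lambda>x. LINT y|lborel. norm (case (x, y) of (x, y) \<Rightarrow> w x y * f x * g y))"
  proof (rule Bochner_Integration.integrable_bound)
    show "integrable lborel (\<lambda>x. B * norm (f x) * (LINT y|lborel. norm (g y)))"
      using f by simp
    show "AE x in lborel. norm (LINT y|lborel. norm (case (x, y) of (x, y) \<Rightarrow> w x y * f x * g y))
        \<le> norm (B * norm (f x) * (LINT y|lborel. norm (g y)))"
    proof (rule AE_I2)
      fix x
      have "(LINT y|lborel. norm (w x y * f x * g y)) \<le> (LINT y|lborel. B * norm (f x) * norm (g y))"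
        by (intro integral_mono integrable_norm[OF i] ig le)
      then show "norm (LINT y|lborel. norm (case (x, y) of (x, y) \<Rightarrow> w x y * f x * g y))
        \<le> norm (B * norm (f x) * (LINT y|lborel. norm (g y)))"
        using B by (simp add: abs_mult)
    qed
  qed simp
qed

lemma Fubini_bounded_product:
  fixes w :: "'a::euclidean_space \<Rightarrow> 'b::euclidean_space \<Rightarrow> complex"
  assumes "(\<lambda>(x, y). w x y) \<in> borel_measurable borel" "\<And>x y. norm (w x y) \<le> B"
    and "integrable lborel f" and "integrable lborel g"
  shows "(LINT x|lborel. LINT y|lborel. w x y * f x * g y) = (LINT y|lborel. LINT x|lborel. w x y * f x * g y)"
  using lborel_pair.Fubini_integral[OF integrable_bounded_product[OF assms]] by simp

lemma lborel_integral_prod: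
  fixes f :: "'a::euclidean_space \<Rightarrow> real \<Rightarrow> 'c::{real_normed_field, banach, second_countable_topology}"
  assumes "\<And>b. b \<in> Basis \<Longrightarrow> integrable lborel (f b)"
  shows "integrable lborel (\<lambda>x. \<Prod>b\<in>Basis. f b (x \<bullet> b))"
    and "(LINT x|lborel. (\<Prod>b\<in>Basis. f b (x \<bullet> b))) = (\<Prod>b\<in>Basis. LINT x|lborel. f b x)"
proof -
  interpret product_sigma_finite "\<lambda>_::'a. lborel :: real measure"
    by standard
  have [measurable]: "f b \<in> borel_measurable borel" if "b \<in> Basis" for b
    using borel_measurable_integrable[OF assms[OF that]] by simp
  have m: "(\<lambda>x. \<Prod>b\<in>Basis. f b (x \<bullet> b)) \<in> borel_measurable borel"
    by measurable
  have T: "(\<lambda>f. \<Sum>b\<in>Basis. f b *\<^sub>R b) \<in> (\<Pi>\<^sub>M b\<in>Basis. lborel) \<rightarrow>\<^sub>M (borel :: 'a measure)"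
    by measurable
  have eq: "(\<Prod>b\<in>Basis. f b ((\<Sum>b\<in>Basis. y b *\<^sub>R b) \<bullet> b)) = (\<Prod>b\<in>Basis. f b (y b))" for y
    by (rule prod.cong) auto
  show "integrable lborel (\<lambda>x. \<Prod>b\<in>Basis. f b (x \<bullet> b))"
    unfolding lborel_eq[where 'a = 'a] integrable_distr_eq[OF T m] eq
    by (rule product_integrable_prod) (auto intro: assms)
  show "(LINT x|lborel. (\<Prod>b\<in>Basis. f b (x \<bullet> b))) = (\<Prod>b\<in>Basis. LINT x|lborel. f b x)"
    unfolding lborel_eq[where 'a = 'a] integral_distr[OF T m] eq
    by (rule product_integral_prod) (auto intro: assms)
qed

section \<open>Test functions\<close>

lemma test_functionD:
  assumes "f \<in> test_functions"
  shows "smooth f" "\<exists>a. \<forall>t. t \<notin> cbox (- a) a \<longrightarrow> f t = 0"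
proof -
  show "smooth f" using assms by (simp add: test_functions_def)
  have "bounded (supp f)"
    using assms by (simp add: test_functions_def compact_imp_bounded)
  then obtain a where "supp f \<subseteq> cbox (- a) a"
    using bounded_subset_cbox_symmetric by blast
  moreover have "{x. f x \<noteq> 0} \<subseteq> supp f"
    by (simp add: supp_def closure_subset)
  ultimately show "\<exists>a. \<forall>t. t \<notin> cbox (- a) a \<longrightarrow> f t = 0"
    by blast
qed

lemma test_functionI:
  assumes "smooth f" "\<And>t. t \<notin> cbox a b \<Longrightarrow> f t = 0"
  shows "f \<in> test_functions"
proof -
  have "supp f \<subseteq> cbox a b"
    unfolding supp_def by (rule closure_minimal) (use assms(2) in auto)
  then have "bounded (supp f)"
    using bounded_cbox bounded_subset by blast
  then show ?thesis
    using assms(1) by (simp add: test_functions_def compact_eq_bounded_closed supp_def)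
qed

lemma test_function_slice:
  assumes "smooth H" "properly_supported H"
  shows "(\<lambda>w. H (x, w)) \<in> test_functions"
proof -
  obtain a where "\<And>p t. norm p \<le> norm x \<Longrightarrow> t \<notin> cbox (- a) a \<Longrightarrow> H (p, t) = 0"
    using properly_supportedE[OF assms(2)] by blast
  then show ?thesis
    by (intro test_functionI[of _ "- a" a] smooth_slice assms(1)) auto
qed

lemma test_function_integrable:
  assumes "f \<in> test_functions"
  shows "integrable lborel f"
  using test_functionD[OF assms] by (meson integral_compactly_supported(1) smooth_continuous_on)

lemma test_function_bounded:
  assumes "f \<in> test_functions"
  obtains B where "\<And>x. norm (f x) \<le> B" "B \<ge> 0"
proof -
  obtain a where a: "\<And>t. t \<notin> cbox (- a) a \<Longrightarrow> f t = 0"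
    using test_functionD(2)[OF assms] by blast
  have "bounded (f ` cbox (- a) a)"
    by (intro compact_imp_bounded compact_continuous_image smooth_continuous_on test_functionD(1)[OF assms] compact_cbox)
  then obtain B where "B > 0" "\<And>x. x \<in> cbox (- a) a \<Longrightarrow> norm (f x) \<le> B"
    by (auto simp: bounded_pos)
  then have "norm (f x) \<le> B" for x
    using a[of x] by (cases "x \<in> cbox (- a) a") auto
  with \<open>B > 0\<close> show thesis
    using that by (meson less_imp_le)
qed

lemma test_function_properly_supported:
  assumes "f \<in> test_functions"
  shows "smooth (\<lambda>z :: 'a::euclidean_space \<times> _. f (snd z))"
    and "properly_supported (\<lambda>z :: 'a \<times> _. f (snd z))"
proof -
  show "smooth (\<lambda>z :: 'a \<times> _. f (snd z))"
    by (intro smooth_compose[OF test_functionD(1)[OF assms]] smooth_intros)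
  obtain a where a: "\<And>t. t \<notin> cbox (- a) a \<Longrightarrow> f t = 0"
    using test_functionD(2)[OF assms] by blast
  obtain B where B: "\<And>t. t \<in> cbox (- a) a \<Longrightarrow> norm t \<le> B"
    using bounded_cbox[of "- a" a] by (auto simp: bounded_iff)
  show "properly_supported (\<lambda>z :: 'a \<times> _. f (snd z))"
    unfolding properly_supported_def using a B by (metis not_le snd_conv)
qed

lemma test_function_reflect:
  fixes f :: "'a::euclidean_space \<Rightarrow> complex"
  assumes f: "f \<in> test_functions"
  shows "(\<lambda>z. f (x - z)) \<in> test_functions"
proof -
  obtain a where a: "\<And>t. t \<notin> cbox (- a) a \<Longrightarrow> f t = 0"
    using test_functionD(2)[OF f] by blast
  show ?thesis
  proof (rule test_functionI)
    show "smooth (\<lambda>z. f (x - z))"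
      by (intro smooth_compose[OF test_functionD(1)[OF f]] smooth_intros)
    show "f (x - z) = 0" if z: "z \<notin> cbox (x - a) (x + a)" for z
    proof (rule a, rule notI)
      assume "x - z \<in> cbox (- a) a"
      then have "z \<in> cbox (x - a) (x + a)"
        by (force simp: mem_box inner_diff_left inner_add_left)
      with z show False ..
    qed
  qed
qed

lemma test_function_mult:
  assumes "smooth g" "f \<in> test_functions"
  shows "(\<lambda>x. g x * f x) \<in> test_functions"
proof -
  obtain a where "\<And>t. t \<notin> cbox (- a) a \<Longrightarrow> f t = 0"
    using test_functionD(2)[OF assms(2)] by blast
  then show ?thesis
    by (intro test_functionI[of _ "- a" a] smooth_mult assms(1) test_functionD(1)[OF assms(2)]) auto
qed

lemma test_function_partial:
  assumes f: "f \<in> test_functions"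
  shows "partial v f \<in> test_functions"
proof -
  obtain a where a: "\<And>t. t \<notin> cbox (- a) a \<Longrightarrow> f t = 0"
    using test_functionD(2)[OF f] by blast
  have "partial v f t = 0" if "t \<notin> cbox (- a) a" for t
  proof -
    have "(f has_derivative (\<lambda>_. 0)) (at t)"
      by (rule has_derivative_transform_within_open[OF has_derivative_const[of 0], where s = "- cbox (- a) a"])
         (use that a in \<open>auto simp: open_Compl closed_cbox\<close>)
    then show ?thesis
      by (rule partial_eqI)
  qed
  then show ?thesis
    by (intro test_functionI[of _ "- a" a] smooth_partial test_functionD(1)[OF f])
qed

text \<open>
  The integral of \<open>f(t + p v)\<close> over \<open>t\<close> does not depend on the real number \<open>p\<close>; differentiate this
  under the integral sign at \<open>p = 0\<close>.
\<close>

lemma integral_partial_eq_0: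
  fixes f :: "'a::euclidean_space \<Rightarrow> complex"
  assumes f: "f \<in> test_functions"
  shows "(LINT x|lborel. partial v f x) = 0"
proof -
  let ?\<Phi> = "\<lambda>z :: real \<times> 'a. f (snd z + fst z *\<^sub>R v)"
  have smooth: "smooth ?\<Phi>"
    by (intro smooth_compose[OF test_functionD(1)[OF f]] smooth_intros)
  obtain a where a: "\<And>t. t \<notin> cbox (- a) a \<Longrightarrow> f t = 0"
    using test_functionD(2)[OF f] by blast
  obtain B where B: "\<And>t. t \<in> cbox (- a) a \<Longrightarrow> norm t \<le> B"
    using bounded_cbox[of "- a" a] by (auto simp: bounded_iff)
  \<comment> \<open>If \<open>f\<close> vanishes outside the ball of radius \<open>B\<close>, then \<open>|t| > B + R |v|\<close> puts \<open>t + p v\<close> outside it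
    for all \<open>|p| \<le> R\<close>.\<close>
  have "properly_supported ?\<Phi>"
    unfolding properly_supported_def
  proof (intro allI exI impI)
    fix R p :: real and t :: 'a
    assume p: "norm p \<le> R" and t: "B + R * norm v < norm t"
    have "norm t \<le> norm (t + p *\<^sub>R v) + \<bar>p\<bar> * norm v"
      using norm_triangle_ineq4[of "t + p *\<^sub>R v" "p *\<^sub>R v"] by simp
    moreover have "\<bar>p\<bar> * norm v \<le> R * norm v"
      using p by (intro mult_right_mono) auto
    ultimately have "t + p *\<^sub>R v \<notin> cbox (- a) a"
      using t B[of "t + p *\<^sub>R v"] by force
    then show "?\<Phi> (p, t) = 0"
      using a by simp
  qed
  from has_derivative_integral_properly_supported[OF smooth this, of 0]
  have "((\<lambda>p. LINT t|lborel. f (t + p *\<^sub>R v)) has_derivative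
      (\<lambda>h. LINT t|lborel. partial (h, 0) ?\<Phi> (0, t))) (at 0)"
    by simp
  moreover have "(LINT t|lborel. f (t + p *\<^sub>R v)) = integral\<^sup>L lborel f" for p
    using integral_affine[of 1 f "p *\<^sub>R v"] by (simp add: add.commute)
  moreover have "partial (1, 0) ?\<Phi> (0, t) = partial v f t" for t
  proof (rule partial_eqI[THEN trans])
    have "(f has_derivative (\<lambda>v. partial v f t)) (at (snd (0::real, t) + fst (0::real, t) *\<^sub>R v))"
      using smooth_has_derivative[OF test_functionD(1)[OF f], of t] by simp
    then show "(?\<Phi> has_derivative (\<lambda>h. partial (snd h + fst h *\<^sub>R v) f t)) (at (0, t))"
      by (rule has_derivative_compose[rotated]) (auto intro!: derivative_eq_intros)
  qed simp
  ultimately have "((\<lambda>p::real. integral\<^sup>L lborel f) has_derivative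
      (\<lambda>h. LINT t|lborel. partial (h, 0) ?\<Phi> (0, t))) (at 0)"
    by simp
  then have "(\<lambda>h. LINT t|lborel. partial (h, 0) ?\<Phi> (0, t)) = (\<lambda>h. 0)"
    using has_derivative_const has_derivative_unique by blast
  then have "(LINT t|lborel. partial (1, 0) ?\<Phi> (0, t)) = 0"
    by meson
  then show ?thesis
    using \<open>\<And>t. partial (1, 0) ?\<Phi> (0, t) = partial v f t\<close> by simp
qed

section \<open>The Fourier transform of test functions\<close>

abbreviation wave :: "'a::real_inner \<Rightarrow> 'a \<Rightarrow> complex" where
  "wave \<xi> x \<equiv> exp (- (\<i> * of_real (\<xi> \<bullet> x)))"

lemma has_derivative_wave:
  "(wave \<xi> has_derivative (\<lambda>h. wave \<xi> x * - (\<i> * of_real (\<xi> \<bullet> h)))) (at x)"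
proof (rule has_derivative_compose[where g = exp and g' = "(*) (wave \<xi> x)"])
  show "((\<lambda>x. - (\<i> * of_real (\<xi> \<bullet> x))) has_derivative (\<lambda>h. - (\<i> * of_real (\<xi> \<bullet> h)))) (at x)"
    by (auto intro!: derivative_eq_intros)
  show "(exp has_derivative (*) (wave \<xi> x)) (at (- (\<i> * of_real (\<xi> \<bullet> x))))"
    using DERIV_exp by (simp only: has_field_derivative_def)
qed

text \<open>
  Multiplying \<open>H(x, w)\<close> by the wave in \<open>w\<close> with frequency \<open>\<xi>\<close> gives a properly supported function
  of \<open>w\<close> with the parameter \<open>(x, \<xi>)\<close>.
\<close>

lemma smooth_fourier:
  fixes H :: "'a::euclidean_space \<times> 'b::euclidean_space \<Rightarrow> complex"
  assumes "smooth H" "properly_supported H"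
  shows "smooth (\<lambda>(x, \<xi>). fourier (\<lambda>w. H (x, w)) \<xi>)"
proof -
  let ?\<Phi> = "\<lambda>z. wave (snd (fst z)) (snd z) * H (fst (fst z), snd z)"
  have "properly_supported ?\<Phi>"
  proof (rule properly_supported_mult, unfold properly_supported_def, intro allI)
    fix R
    obtain R' where R': "\<And>p t. norm p \<le> R \<Longrightarrow> R' < norm t \<Longrightarrow> H (p, t) = 0"
      using assms(2) unfolding properly_supported_def by blast
    have "H (fst p, t) = 0" if "norm p \<le> R" "R' < norm t" for p :: "'a \<times> 'b" and t
      using R'[OF order_trans[OF norm_fst_le[of "fst p" "snd p"]]] that by simp
    then show "\<exists>R'. \<forall>p t. norm p \<le> R \<longrightarrow> R' < norm t \<longrightarrow>
        H (fst (fst (p :: 'a \<times> 'b, t)), snd (p, t)) = 0"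
      by (intro exI[of _ R']) auto
  qed
  moreover have "smooth ?\<Phi>"
    by (intro smooth_intros smooth_compose[OF assms(1)])
  ultimately show ?thesis
    using smooth_integral_properly_supported[of ?\<Phi>] by (simp add: case_prod_unfold fourier_def)
qed

lemma partial_fourier_parameter:
  fixes H :: "'a::euclidean_space \<times> 'b::euclidean_space \<Rightarrow> complex"
  assumes "smooth H" "properly_supported H"
  shows "partial v (\<lambda>x. fourier (\<lambda>w. H (x, w)) \<xi>) x = fourier (\<lambda>w. partial (v, 0) H (x, w)) \<xi>"
proof -
  let ?\<Phi> = "\<lambda>z. wave \<xi> (snd z) * H z"
  have d: "partial (v, 0) ?\<Phi> (x, w) = wave \<xi> w * partial (v, 0) H (x, w)" for w
  proof -
    have der: "((\<lambda>x. ?\<Phi> (x, w)) has_derivative (\<lambda>v. wave \<xi> w * partial (v, 0) H (x, w))) (at x)"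
      using has_derivative_mult_right[OF smooth_has_derivative[OF smooth_slice(1)[OF assms(1)]]]
      by (simp add: partial_slice(1)[OF assms(1)])
    have "smooth ?\<Phi>"
      by (intro smooth_intros assms(1))
    from partial_fst_eqI[OF this der] show ?thesis .
  qed
  have "smooth ?\<Phi>" "properly_supported ?\<Phi>"
    by (intro smooth_intros assms properly_supported_mult)+
  from partial_integral_properly_supported[OF this, of v] show ?thesis
    by (simp add: fourier_def fun_eq_iff d)
qed

lemma has_derivative_fourier:
  fixes f :: "'a::euclidean_space \<Rightarrow> complex"
  assumes f: "f \<in> test_functions"
  shows "(fourier f has_derivative
    (\<lambda>v. fourier (\<lambda>w. - (\<i> * of_real (w \<bullet> v)) * f w) \<xi>)) (at \<xi>)"
proof -
  let ?\<Phi> = "\<lambda>z :: 'a \<times> 'a. wave (fst z) (snd z) * f (snd z)"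
  have "smooth (\<lambda>z :: 'a \<times> 'a. f (snd z))"
    by (rule test_function_properly_supported(1)[OF f])
  then have s: "smooth ?\<Phi>"
    by (rule smooth_mult[rotated]) (intro smooth_intros)
  have p: "properly_supported ?\<Phi>"
    by (rule properly_supported_mult[OF test_function_properly_supported(2)[OF f]])
  have d: "partial (v, 0) ?\<Phi> (\<xi>, w) = wave \<xi> w * (- (\<i> * of_real (w \<bullet> v)) * f w)" for v w
  proof -
    have "((\<lambda>\<xi>. wave \<xi> w) has_derivative (\<lambda>v. wave \<xi> w * - (\<i> * of_real (v \<bullet> w)))) (at \<xi>)"
      using has_derivative_wave[of w \<xi>] by (simp only: inner_commute[of w])
    then have "((\<lambda>\<xi>. ?\<Phi> (\<xi>, w)) has_derivative (\<lambda>v. wave \<xi> w * - (\<i> * of_real (v \<bullet> w)) * f w)) (at \<xi>)"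
      unfolding fst_conv snd_conv by (rule has_derivative_mult_left)
    from partial_fst_eqI[OF s this] show ?thesis
      by (simp add: inner_commute)
  qed
  show ?thesis
    using has_derivative_integral_properly_supported[OF s p, of \<xi>]
    unfolding d by (simp add: fourier_def[abs_def])
qed

text \<open>
  Integration by parts, in the form that the integral of the derivative \<open>\<partial>\<^sub>v\<close> of the product of \<open>f\<close>
  and the wave vanishes.
\<close>

lemma fourier_of_partial:
  assumes f: "f \<in> test_functions"
  shows "fourier (partial v f) \<xi> = \<i> * of_real (\<xi> \<bullet> v) * fourier f \<xi>"
proof -
  have w: "smooth (wave \<xi>)"
    by (intro smooth_intros)
  have d: "partial v (\<lambda>x. wave \<xi> x * f x) x =
      wave \<xi> x * partial v f x - \<i> * of_real (\<xi> \<bullet> v) * (wave \<xi> x * f x)" for x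
    using has_derivative_mult[OF has_derivative_wave smooth_has_derivative[OF test_functionD(1)[OF f]]]
    by (subst partial_eqI) (auto simp: algebra_simps)
  have "(LINT x|lborel. wave \<xi> x * partial v f x - \<i> * of_real (\<xi> \<bullet> v) * (wave \<xi> x * f x)) = 0"
    using integral_partial_eq_0[OF test_function_mult[OF w f], of v] by (simp add: d)
  moreover have "integrable lborel (\<lambda>x. wave \<xi> x * partial v f x)"
    "integrable lborel (\<lambda>x. wave \<xi> x * f x)"
    by (intro test_function_integrable test_function_mult test_function_partial w f)+
  ultimately show ?thesis
    unfolding fourier_def by (subst (asm) Bochner_Integration.integral_diff) auto
qed

text \<open>
  Because of \<open>1 + |\<xi>| \<le> 1 + \<Sum>\<^sub>b |\<xi>\<^sub>b|\<close>, one more power of \<open>1 + |\<xi>|\<close> costs one partial derivative of \<open>H\<close>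
  in the second variable. The partial derivatives have the same properties as \<open>H\<close>, and so
  the induction is over all functions \<open>H\<close>.
\<close>

lemma fourier_rapid_decay:
  fixes H :: "'a::euclidean_space \<times> 'b::euclidean_space \<Rightarrow> complex"
  assumes "smooth H" "properly_supported H"
  shows "\<exists>C. \<forall>x \<xi>. norm x \<le> R \<longrightarrow> (1 + norm \<xi>) ^ N * norm (fourier (\<lambda>w. H (x, w)) \<xi>) \<le> C"
  using assms
proof (induction N arbitrary: H)
  case 0
  obtain a where a: "\<And>x w. norm x \<le> R \<Longrightarrow> w \<notin> cbox (- a) a \<Longrightarrow> H (x, w) = 0"
    using properly_supportedE[OF 0(2)] by blast
  have "bounded (H ` (cball 0 R \<times> cbox (- a) a))"
    by (intro compact_imp_bounded compact_continuous_image smooth_continuous_on 0 compact_Times) auto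
  then obtain B where B: "B > 0" "\<And>x w. norm x \<le> R \<Longrightarrow> w \<in> cbox (- a) a \<Longrightarrow> norm (H (x, w)) \<le> B"
    by (auto simp: bounded_pos)
  have "norm (fourier (\<lambda>w. H (x, w)) \<xi>) \<le> (LINT w|lborel. indicator (cbox (- a) a) w * B)"
    if "norm x \<le> R" for x \<xi>
    unfolding fourier_def
  proof (rule Bochner_Integration.integral_norm_bound_integral)
    show "integrable lborel (\<lambda>w. wave \<xi> w * H (x, w))"
      by (intro test_function_integrable test_function_mult test_function_slice smooth_intros 0)
    show "integrable lborel (\<lambda>w. indicator (cbox (- a) a) w * B)"
      by (intro integrable_mult_left integrable_real_indicator emeasure_lborel_cbox_finite) auto
    show "norm (wave \<xi> w * H (x, w)) \<le> indicator (cbox (- a) a) w * B" for w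
      using a[OF that] B(2)[OF that] by (cases "w \<in> cbox (- a) a") (auto simp: norm_mult)
  qed
  then show ?case
    by auto
next
  case (Suc N)
  obtain C where C: "\<And>x \<xi>. norm x \<le> R \<Longrightarrow> (1 + norm \<xi>) ^ N * norm (fourier (\<lambda>w. H (x, w)) \<xi>) \<le> C"
    using Suc by blast
  have "\<exists>C. \<forall>x \<xi>. norm x \<le> R \<longrightarrow> (1 + norm \<xi>) ^ N * norm (fourier (\<lambda>w. partial (0, b) H (x, w)) \<xi>) \<le> C"
    for b
    by (intro Suc.IH smooth_partial properly_supported_partial Suc.prems)
  then obtain D where D: "\<And>b x \<xi>. norm x \<le> R \<Longrightarrow>
      (1 + norm \<xi>) ^ N * norm (fourier (\<lambda>w. partial (0, b) H (x, w)) \<xi>) \<le> D b"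
    by metis
  have "(1 + norm \<xi>) ^ Suc N * norm (fourier (\<lambda>w. H (x, w)) \<xi>) \<le> C + (\<Sum>b\<in>Basis. D b)"
    if x: "norm x \<le> R" for x \<xi>
  proof -
    let ?F = "norm (fourier (\<lambda>w. H (x, w)) \<xi>)"
    have F: "\<bar>\<xi> \<bullet> b\<bar> * ?F = norm (fourier (\<lambda>w. partial (0, b) H (x, w)) \<xi>)" for b
    proof -
      have "partial b (\<lambda>w. H (x, w)) = (\<lambda>w. partial (0, b) H (x, w))"
        by (rule ext) (rule partial_slice(2)[OF Suc.prems(1)])
      then show ?thesis
        using fourier_of_partial[OF test_function_slice[OF Suc.prems, of x], of b \<xi>] by (simp add: norm_mult)
    qed
    have "(1 + norm \<xi>) * ?F \<le> (1 + (\<Sum>b\<in>Basis. \<bar>\<xi> \<bullet> b\<bar>)) * ?F"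
      by (intro mult_right_mono add_left_mono norm_le_l1) auto
    also have "\<dots> = ?F + (\<Sum>b\<in>Basis. norm (fourier (\<lambda>w. partial (0, b) H (x, w)) \<xi>))"
      by (simp add: ring_distribs sum_distrib_right F)
    finally have "(1 + norm \<xi>) ^ N * ((1 + norm \<xi>) * ?F) \<le>
        (1 + norm \<xi>) ^ N * (?F + (\<Sum>b\<in>Basis. norm (fourier (\<lambda>w. partial (0, b) H (x, w)) \<xi>)))"
      by (intro mult_left_mono) auto
    also have "\<dots> = (1 + norm \<xi>) ^ N * ?F +
        (\<Sum>b\<in>Basis. (1 + norm \<xi>) ^ N * norm (fourier (\<lambda>w. partial (0, b) H (x, w)) \<xi>))"
      by (simp add: ring_distribs sum_distrib_left)
    also have "\<dots> \<le> C + (\<Sum>b\<in>Basis. D b)"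
      by (intro add_mono sum_mono C D x)
    finally show ?thesis
      by (simp add: mult.assoc mult.left_commute)
  qed
  then show ?case
    by blast
qed


text \<open>
  An integrable function of product form that decays only polynomially; it dominates the Fourier
  transforms of test functions.
\<close>

lemma integrable_prod_inverse_1_plus_square:
  "integrable lborel (\<lambda>x::'a::euclidean_space. \<Prod>b\<in>Basis. inverse (1 + (x \<bullet> b)\<^sup>2))"
  using integrable_inverse_1_plus_square
  by (intro lborel_integral_prod(1)) (simp add: set_integrable_def)

lemma fourier_integrable:
  fixes f :: "'a::euclidean_space \<Rightarrow> complex"
  assumes f: "f \<in> test_functions"
  shows "integrable lborel (fourier f)"
proof -
  note H = test_function_properly_supported[OF f, where ?'a = real]
  obtain C where C: "\<And>\<xi>. (1 + norm \<xi>) ^ (2 * DIM('a)) * norm (fourier f \<xi>) \<le> C"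
    using fourier_rapid_decay[OF H, of 0 "2 * DIM('a)"] by auto
  have [measurable]: "fourier f \<in> borel_measurable borel"
    using smooth_measurable[OF smooth_slice(2)[OF smooth_fourier[OF H], of 0]] by simp
  have le: "(\<Prod>b\<in>Basis. 1 + (\<xi> \<bullet> b)\<^sup>2) \<le> (1 + norm \<xi>) ^ (2 * DIM('a))" for \<xi> :: 'a
  proof -
    have "1 + (\<xi> \<bullet> b)\<^sup>2 \<le> (1 + norm \<xi>)\<^sup>2" if "b \<in> Basis" for b
    proof -
      have "(\<xi> \<bullet> b)\<^sup>2 \<le> (norm \<xi>)\<^sup>2"
        using Basis_le_norm[OF that, of \<xi>] by (metis abs_le_square_iff abs_norm_cancel)
      then show ?thesis
        using norm_ge_zero[of \<xi>] by (simp add: power2_sum del: norm_ge_zero)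
    qed
    then have "(\<Prod>b\<in>Basis. 1 + (\<xi> \<bullet> b)\<^sup>2) \<le> (\<Prod>b\<in>(Basis :: 'a set). (1 + norm \<xi>)\<^sup>2)"
      by (intro prod_mono) auto
    then show ?thesis
      by (simp add: power_mult)
  qed
  have "norm (fourier f \<xi>) \<le> C * (\<Prod>b\<in>Basis. inverse (1 + (\<xi> \<bullet> b)\<^sup>2))" for \<xi>
  proof -
    have pos: "(\<Prod>b\<in>Basis. 1 + (\<xi> \<bullet> b)\<^sup>2) > 0"
      by (intro prod_pos) (auto intro: add_pos_nonneg)
    have "(\<Prod>b\<in>Basis. 1 + (\<xi> \<bullet> b)\<^sup>2) * norm (fourier f \<xi>) \<le> C"
      using mult_right_mono[OF le[of \<xi>] norm_ge_zero[of "fourier f \<xi>"]] C[of \<xi>] by linarith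
    moreover have "(\<Prod>b\<in>Basis. inverse (1 + (\<xi> \<bullet> b)\<^sup>2)) = inverse (\<Prod>b\<in>Basis. 1 + (\<xi> \<bullet> b)\<^sup>2)"
      using prod_inversef[of "\<lambda>b. 1 + (\<xi> \<bullet> b)\<^sup>2" Basis] by (simp add: comp_def)
    ultimately show ?thesis
      using pos by (simp add: divide_inverse[symmetric] pos_le_divide_eq mult.commute)
  qed
  then show ?thesis
    by (intro Bochner_Integration.integrable_bound[OF integrable_mult_right[OF integrable_prod_inverse_1_plus_square, of C]])
       (auto intro: order_trans[OF _ abs_ge_self])
qed

section \<open>Fourier inversion\<close>

text \<open>
  The characteristic function of the standard normal distribution, without the normalization.
\<close>

lemma gaussian_1d:
  fixes t :: real
  shows "integrable lborel (\<lambda>x. wave x t * of_real (exp (- x\<^sup>2 / 2)))"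
    and "(LINT x|lborel. wave x t * of_real (exp (- x\<^sup>2 / 2))) = of_real (sqrt (2 * pi) * exp (- t\<^sup>2 / 2))"
proof -
  have d: "std_normal_density x = inverse (sqrt (2 * pi)) * exp (- x\<^sup>2 / 2)" for x
    by (simp add: std_normal_density_def field_simps)
  have "integrable lborel (\<lambda>x. sqrt (2 * pi) * std_normal_density x)"
    by (intro integrable_mult_right) simp
  then have i: "integrable lborel (\<lambda>x. exp (- x\<^sup>2 / 2) :: real)"
    by (simp add: d)
  show int: "integrable lborel (\<lambda>x. wave x t * of_real (exp (- x\<^sup>2 / 2)))"
    by (rule Bochner_Integration.integrable_bound[OF i]) (auto simp: norm_mult)
  have "of_real (exp (- t\<^sup>2 / 2)) = char std_normal_distribution (- t)"
    by (simp add: char_std_normal_distribution)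
  also have "\<dots> = (LINT x|lborel. std_normal_density x *\<^sub>R iexp (- t * x))"
    unfolding char_def by (subst integral_density) auto
  also have "\<dots> = (LINT x|lborel. of_real (inverse (sqrt (2 * pi))) * (wave x t * of_real (exp (- x\<^sup>2 / 2))))"
    by (simp add: d scaleR_conv_of_real mult_ac)
  also have "\<dots> = of_real (inverse (sqrt (2 * pi))) * (LINT x|lborel. wave x t * of_real (exp (- x\<^sup>2 / 2)))"
    by simp
  finally show "(LINT x|lborel. wave x t * of_real (exp (- x\<^sup>2 / 2))) = of_real (sqrt (2 * pi) * exp (- t\<^sup>2 / 2))"
    by (simp add: field_simps)
qed

definition gaussian :: "'a::euclidean_space \<Rightarrow> complex" where
  "gaussian x = of_real (exp (- (x \<bullet> x) / 2))"

text \<open>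
  The integrand of the Fourier integral of the Gaussian splits into functions of one coordinate,
  which reduces the Fourier transform of the Gaussian to dimension one.
\<close>

lemma wave_mult_gaussian:
  "wave x y * gaussian x = (\<Prod>b\<in>Basis. wave (x \<bullet> b) (y \<bullet> b) * of_real (exp (- (x \<bullet> b)\<^sup>2 / 2)))"
proof -
  have "wave x y = (\<Prod>b\<in>Basis. wave (x \<bullet> b) (y \<bullet> b))"
    by (subst euclidean_inner) (simp add: exp_sum sum_distrib_left sum_negf[symmetric] inner_real_def)
  moreover have "gaussian x = (\<Prod>b\<in>Basis. of_real (exp (- (x \<bullet> b)\<^sup>2 / 2)))"
    unfolding gaussian_def
    by (subst euclidean_inner)
       (simp add: exp_sum[symmetric] sum_negf sum_divide_distrib[symmetric] power2_eq_square of_real_prod[symmetric] del: of_real_prod)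
  ultimately show ?thesis
    by (simp add: prod.distrib)
qed

lemma gaussian_integrable: "integrable lborel (gaussian :: 'a::euclidean_space \<Rightarrow> complex)"
proof -
  have "integrable lborel (\<lambda>x::'a. wave x 0 * gaussian x)"
    unfolding wave_mult_gaussian by (rule lborel_integral_prod(1)) (rule gaussian_1d(1))
  then show ?thesis by simp
qed

lemma fourier_gaussian:
  "(LINT x|lborel. wave x y * gaussian x) = (of_real (sqrt (2 * pi))) ^ DIM('a) * gaussian (y :: 'a::euclidean_space)"
proof -
  have "(LINT x|lborel. wave x y * gaussian x) =
      (\<Prod>b\<in>(Basis :: 'a set). of_real (sqrt (2 * pi)) * (wave 0 (y \<bullet> b) * of_real (exp (- (y \<bullet> b)\<^sup>2 / 2))))"
    unfolding wave_mult_gaussian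
    by (subst lborel_integral_prod(2)) (rule gaussian_1d(1), simp only: gaussian_1d(2), simp)
  also have "\<dots> = (of_real (sqrt (2 * pi))) ^ DIM('a) * (wave y 0 * gaussian y)"
    unfolding wave_mult_gaussian by (simp add: prod.distrib)
  finally show ?thesis by simp
qed


lemma wave_measurable:
  "(\<lambda>(x, y). wave (g x) (h y)) \<in> borel_measurable borel" if "continuous_on UNIV g" "continuous_on UNIV h"
  for g :: "'a::topological_space \<Rightarrow> 'c::real_inner" and h :: "'b::topological_space \<Rightarrow> 'c"
  unfolding case_prod_unfold
  by (intro borel_measurable_continuous_onI continuous_intros continuous_on_compose2[OF that(1)] continuous_on_compose2[OF that(2)]) auto

lemma fourier_multiplication_formula:
  assumes "integrable lborel f" "integrable lborel g"
  shows "(LINT \<xi>|lborel. fourier f \<xi> * g \<xi>) = (LINT y|lborel. f y * (LINT \<xi>|lborel. wave \<xi> y * g \<xi>))"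
proof -
  have "(LINT \<xi>|lborel. fourier f \<xi> * g \<xi>) = (LINT \<xi>|lborel. LINT y|lborel. wave \<xi> y * g \<xi> * f y)"
    unfolding fourier_def integral_mult_left_zero[symmetric] by (simp add: mult_ac)
  also have "\<dots> = (LINT y|lborel. LINT \<xi>|lborel. wave \<xi> y * g \<xi> * f y)"
    using assms by (intro Fubini_bounded_product[where B = 1] wave_measurable continuous_intros) auto
  also have "\<dots> = (LINT y|lborel. f y * (LINT \<xi>|lborel. wave \<xi> y * g \<xi>))"
    unfolding integral_mult_right_zero[symmetric] by (simp add: mult_ac)
  finally show ?thesis .
qed

text \<open>
  Let \<open>g\<close> be the Gaussian. By scaling and by the multiplication formula, the integral of
  \<open>fourier f \<xi> * g (\<epsilon> \<xi>)\<close> equals that of \<open>f (\<epsilon> y)\<close> against the Fourier transform of \<open>g\<close>,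
  which is \<open>(2 \<pi>)\<^sup>n\<^sup>/\<^sup>2 g\<close>. For \<open>\<epsilon> \<rightarrow> 0\<close> the left side tends to the integral of \<open>fourier f\<close>,
  and the right side to \<open>(2 \<pi>)\<^sup>n f(0)\<close>.
\<close>

lemma fourier_inversion_0:
  fixes f :: "'a::euclidean_space \<Rightarrow> complex"
  assumes f: "f \<in> test_functions"
  shows "(LINT \<xi>|lborel. fourier f \<xi>) = (2 * of_real pi) ^ DIM('a) * f 0"
proof -
  define \<epsilon> where "\<epsilon> k = inverse (real (Suc k))" for k
  have \<epsilon>: "\<epsilon> k > 0" for k by (simp add: \<epsilon>_def)
  have \<epsilon>0: "\<epsilon> \<longlonglongrightarrow> 0"
    using LIMSEQ_inverse_real_of_nat by (simp add: \<epsilon>_def[abs_def])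
  note fi = fourier_integrable[OF f]
  have [measurable]: "f \<in> borel_measurable borel" "fourier f \<in> borel_measurable borel"
    "(gaussian :: 'a \<Rightarrow> complex) \<in> borel_measurable borel"
    using smooth_measurable[OF test_functionD(1)[OF f]] borel_measurable_integrable[OF fi]
      borel_measurable_integrable[OF gaussian_integrable[where ?'a = 'a]] by simp_all
  obtain B where B: "\<And>x. norm (f x) \<le> B" "B \<ge> 0"
    using test_function_bounded[OF f] by blast
  let ?c = "of_real (sqrt (2 * pi)) ^ DIM('a) :: complex"
  have g1: "norm (gaussian x) \<le> 1" for x :: 'a
    by (simp add: gaussian_def)
  have gc: "((\<lambda>k. gaussian (\<epsilon> k *\<^sub>R x)) \<longlonglongrightarrow> 1)" for x :: 'a
  proof -
    have "(\<lambda>k. gaussian (\<epsilon> k *\<^sub>R x)) \<longlonglongrightarrow> of_real (exp (- ((0 *\<^sub>R x) \<bullet> (0 *\<^sub>R x)) / 2))"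
      unfolding gaussian_def by (intro tendsto_intros \<epsilon>0) auto
    then show ?thesis by simp
  qed
  have fc: "(\<lambda>k. f (\<epsilon> k *\<^sub>R y)) \<longlonglongrightarrow> f 0" for y
  proof -
    have "isCont f 0"
      using smooth_continuous_on[OF test_functionD(1)[OF f], of UNIV] by (simp add: continuous_on_eq_continuous_at)
    then have "(\<lambda>k. f (\<epsilon> k *\<^sub>R y)) \<longlonglongrightarrow> f (0 *\<^sub>R y)"
      by (intro isCont_tendsto_compose[of _ f]) (auto intro!: tendsto_eq_intros \<epsilon>0)
    then show ?thesis by simp
  qed
  have eq: "(LINT \<xi>|lborel. fourier f \<xi> * gaussian (\<epsilon> k *\<^sub>R \<xi>)) =
      ?c * (LINT y|lborel. f (\<epsilon> k *\<^sub>R y) * gaussian y)" for k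
  proof -
    let ?f = "\<lambda>y. f (\<epsilon> k *\<^sub>R y)"
    have fs: "fourier f (inverse (\<epsilon> k) *\<^sub>R \<xi>) = \<epsilon> k ^ DIM('a) *\<^sub>R fourier ?f \<xi>" for \<xi>
      unfolding fourier_def
      using \<epsilon>[of k]
      by (subst integral_affine[where c = "\<epsilon> k" and t = 0]) (auto simp: mult.assoc[symmetric])
    have "(LINT \<xi>|lborel. fourier f \<xi> * gaussian (\<epsilon> k *\<^sub>R \<xi>)) = (LINT \<xi>|lborel. fourier ?f \<xi> * gaussian \<xi>)"
      using \<epsilon>[of k]
      by (subst integral_affine[where c = "inverse (\<epsilon> k)" and t = 0]) (auto simp: fs power_inverse)
    also have "\<dots> = (LINT y|lborel. ?f y * (LINT \<xi>|lborel. wave \<xi> y * gaussian \<xi>))"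
      using integrable_affine[of "\<epsilon> k" f 0] test_function_integrable[OF f] \<epsilon>[of k]
      by (intro fourier_multiplication_formula gaussian_integrable) auto
    also have "\<dots> = (LINT y|lborel. ?c * (?f y * gaussian y))"
      unfolding fourier_gaussian by (simp add: mult_ac)
    also have "\<dots> = ?c * (LINT y|lborel. f (\<epsilon> k *\<^sub>R y) * gaussian y)"
      by (rule integral_mult_right_zero)
    finally show ?thesis .
  qed
  have lim1: "(\<lambda>k. LINT \<xi>|lborel. fourier f \<xi> * gaussian (\<epsilon> k *\<^sub>R \<xi>)) \<longlonglongrightarrow> (LINT \<xi>|lborel. fourier f \<xi>)"
  proof (rule integral_dominated_convergence)
    show "integrable lborel (\<lambda>\<xi>. norm (fourier f \<xi>))"
      using fi by simp
    show "AE \<xi> in lborel. norm (fourier f \<xi> * gaussian (\<epsilon> k *\<^sub>R \<xi>)) \<le> norm (fourier f \<xi>)" for k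
      by (intro AE_I2) (simp add: norm_mult mult_right_le_one_le g1)
    show "AE \<xi> in lborel. (\<lambda>k. fourier f \<xi> * gaussian (\<epsilon> k *\<^sub>R \<xi>)) \<longlonglongrightarrow> fourier f \<xi>"
      using tendsto_mult[OF tendsto_const gc] by fastforce
  qed measurable
  have "(\<lambda>k. LINT y|lborel. f (\<epsilon> k *\<^sub>R y) * gaussian y) \<longlonglongrightarrow> (LINT y::'a|lborel. f 0 * gaussian y)"
  proof (rule integral_dominated_convergence)
    show "integrable lborel (\<lambda>y::'a. B * norm (gaussian y))"
      using gaussian_integrable by (intro integrable_mult_right integrable_norm)
    show "AE y in lborel. norm (f (\<epsilon> k *\<^sub>R y) * gaussian y) \<le> B * norm (gaussian y)" for k
      by (intro AE_I2) (simp add: norm_mult mult_right_mono B)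
    show "AE y in lborel. (\<lambda>k. f (\<epsilon> k *\<^sub>R y) * gaussian y) \<longlonglongrightarrow> f 0 * gaussian y"
      using tendsto_mult[OF fc tendsto_const] by fastforce
  qed measurable
  then have lim2: "(\<lambda>k. ?c * (LINT y|lborel. f (\<epsilon> k *\<^sub>R y) * gaussian y)) \<longlonglongrightarrow> ?c * (f 0 * (LINT y::'a|lborel. gaussian y))"
    by (intro tendsto_mult tendsto_const) simp
  have "(LINT y::'a|lborel. gaussian y) = ?c"
    using fourier_gaussian[of "0 :: 'a"] by (simp add: gaussian_def)
  then have "(LINT \<xi>|lborel. fourier f \<xi>) = ?c * (f 0 * ?c)"
    using LIMSEQ_unique[OF lim1[unfolded eq] lim2] by simp
  also have "\<dots> = (of_real (sqrt (2 * pi)) * of_real (sqrt (2 * pi))) ^ DIM('a) * f 0"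
    by (simp only: power_mult_distrib mult_ac)
  also have "\<dots> = (2 * of_real pi) ^ DIM('a) * f 0"
    by (simp only: of_real_mult[symmetric] real_sqrt_mult_self) simp
  finally show ?thesis .
qed

text \<open>
  Translating \<open>f\<close> by \<open>x\<close> multiplies its Fourier transform by a wave, so that it is enough to evaluate
  at the origin.
\<close>

proposition fourier_inversion:
  fixes f :: "'a::euclidean_space \<Rightarrow> complex"
  assumes f: "f \<in> test_functions"
  shows "(LINT \<xi>|lborel. exp (\<i> * of_real (\<xi> \<bullet> x)) * fourier f \<xi>) = (2 * of_real pi) ^ DIM('a) * f x"
proof -
  obtain a where a: "\<And>t. t \<notin> cbox (- a) a \<Longrightarrow> f t = 0"
    using test_functionD(2)[OF f] by blast
  have "fourier (\<lambda>y. f (x + y)) \<xi> = exp (\<i> * of_real (\<xi> \<bullet> x)) * fourier f \<xi>" for \<xi>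
  proof -
    have "fourier f \<xi> = (LINT y|lborel. wave \<xi> x * (wave \<xi> y * f (x + y)))"
      unfolding fourier_def
      by (subst integral_affine[where c = 1 and t = x])
         (auto simp: inner_add_right ring_distribs exp_add[symmetric] mult.assoc[symmetric])
    also have "\<dots> = wave \<xi> x * fourier (\<lambda>y. f (x + y)) \<xi>"
      unfolding fourier_def by (rule integral_mult_right_zero)
    finally show ?thesis
      by (simp add: mult.assoc[symmetric] exp_add[symmetric])
  qed
  moreover have "(\<lambda>y. f (x + y)) \<in> test_functions"
  proof (rule test_functionI)
    show "smooth (\<lambda>y. f (x + y))"
      by (intro smooth_compose[OF test_functionD(1)[OF f]] smooth_intros)
    show "f (x + y) = 0" if y: "y \<notin> cbox (- a - x) (a - x)" for y
    proof (rule a, rule notI)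
      assume "x + y \<in> cbox (- a) a"
      then have "y \<in> cbox (- a - x) (a - x)"
        by (force simp: mem_box inner_diff_left inner_add_left)
      with y show False ..
    qed
  qed
  ultimately show ?thesis
    using fourier_inversion_0[of "\<lambda>y. f (x + y)"] by simp
qed

section \<open>Radially averaged Fourier transforms as symbols\<close>

text \<open>
  The list of directions must not depend on the function, since the functions that are
  differentiated depend on further variables.
\<close>

lemma multi_partial_eq_foldr:
  fixes \<alpha> :: "nat^'n::{finite,linorder}"
  obtains vs where "length vs = (\<Sum>i\<in>UNIV. \<alpha> $ i)"
    "\<And>f :: real^'n::{finite,linorder} \<Rightarrow> 'b::real_normed_vector. multi_partial \<alpha> f = foldr partial vs f"
proof -
  let ?l = "\<lambda>is. concat (map (\<lambda>i. replicate (\<alpha> $ i) (axis i 1)) is) :: (real^'n::_) list"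
  have *: "foldr (\<lambda>i. partial (axis i 1) ^^ (\<alpha> $ i)) is f = foldr partial (?l is) f"
    for "is" and f :: "real^'n::_ \<Rightarrow> 'b"
    by (induction "is") auto
  show thesis
  proof (rule that)
    show "length (?l (sorted_list_of_set UNIV)) = (\<Sum>i\<in>UNIV. \<alpha> $ i)"
      using sum_list_distinct_conv_sum_set[of "sorted_list_of_set UNIV" "\<lambda>i. \<alpha> $ i"]
      by (simp add: length_concat comp_def)
    show "multi_partial \<alpha> f = foldr partial (?l (sorted_list_of_set UNIV)) f" for f :: "real^'n::_ \<Rightarrow> 'b"
      unfolding multi_partial_def by (rule *)
  qed
qed

text \<open>
  With \<open>h(x, \<cdot>)\<close> the Fourier transform of \<open>H(x, \<cdot>)\<close>, this is the average of the dilated functions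
  \<open>h(x, r \<xi>)\<close> over \<open>0 \<le> r \<le> 1\<close> with the weight \<open>p\<close>. The dilations are what reduces the rapid decay
  of \<open>h\<close> to decay of a finite order in \<open>\<xi>\<close>.
\<close>

definition radial_symbol ::
    "(real \<Rightarrow> complex) \<Rightarrow> ('a::euclidean_space \<times> 'a \<Rightarrow> complex) \<Rightarrow> 'a \<Rightarrow> 'a \<Rightarrow> complex" where
  "radial_symbol p H x \<xi> = (LINT r:{0..1}|lborel. p r * fourier (\<lambda>w. H (x, w)) (r *\<^sub>R \<xi>))"

lemma radial_symbol_eq_integral:
  assumes "smooth p" "smooth H" "properly_supported H"
  shows "(\<lambda>r. p r * fourier (\<lambda>w. H (x, w)) (r *\<^sub>R \<xi>)) integrable_on {0..1}"
    and "radial_symbol p H x \<xi> = integral {0..1} (\<lambda>r. p r * fourier (\<lambda>w. H (x, w)) (r *\<^sub>R \<xi>))"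
proof -
  have "smooth (\<lambda>r. p r * fourier (\<lambda>w. H (x, w)) (r *\<^sub>R \<xi>))"
    using smooth_compose[OF smooth_fourier[OF assms(2,3)], of "\<lambda>r. (x, r *\<^sub>R \<xi>)"]
    by (intro smooth_mult assms(1)) (simp add: smooth_intros)
  then have cont: "continuous_on (cbox 0 1) (\<lambda>r. p r * fourier (\<lambda>w. H (x, w)) (r *\<^sub>R \<xi>))"
    by (rule smooth_continuous_on)
  show "radial_symbol p H x \<xi> = integral {0..1} (\<lambda>r. p r * fourier (\<lambda>w. H (x, w)) (r *\<^sub>R \<xi>))"
    using set_lebesgue_integral_cbox(2)[OF cont] by (simp add: radial_symbol_def)
  show "(\<lambda>r. p r * fourier (\<lambda>w. H (x, w)) (r *\<^sub>R \<xi>)) integrable_on {0..1}"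
    using integrable_continuous[OF cont] by simp
qed

lemma smooth_radial_symbol:
  assumes "smooth p" "smooth H" "properly_supported H"
  shows "smooth (\<lambda>(x, \<xi>). radial_symbol p H x \<xi>)"
proof -
  let ?\<Phi> = "\<lambda>z. p (snd z) * fourier (\<lambda>w. H (fst (fst z), w)) (snd z *\<^sub>R snd (fst z))"
  have "smooth (\<lambda>z. (\<lambda>(x, \<xi>). fourier (\<lambda>w. H (x, w)) \<xi>) (fst (fst z), snd z *\<^sub>R snd (fst z)))"
    by (intro smooth_compose[OF smooth_fourier[OF assms(2,3)]] smooth_intros)
  then have "smooth ?\<Phi>"
    by (intro smooth_mult smooth_compose[OF assms(1)]) (simp_all add: smooth_intros)
  from smooth_integral_cbox[OF this, of 0 1] show ?thesis
    by (simp add: radial_symbol_eq_integral[OF assms] case_prod_unfold)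
qed

text \<open>
  The variable \<open>x\<close> enters through \<open>H\<close> only.
\<close>

lemma partial_radial_symbol_x:
  assumes "smooth p" "smooth H" "properly_supported H"
  shows "partial v (\<lambda>x. radial_symbol p H x \<xi>) = (\<lambda>x. radial_symbol p (partial (v, 0) H) x \<xi>)"
proof
  fix x
  let ?\<Phi> = "\<lambda>z. p (snd z) * fourier (\<lambda>w. H (fst z, w)) (snd z *\<^sub>R \<xi>)"
  have "smooth (\<lambda>z. (\<lambda>(x, \<xi>). fourier (\<lambda>w. H (x, w)) \<xi>) (fst z, snd z *\<^sub>R \<xi>))"
    by (intro smooth_compose[OF smooth_fourier[OF assms(2,3)]] smooth_intros)
  then have s: "smooth ?\<Phi>"
    by (intro smooth_mult smooth_compose[OF assms(1)]) (simp_all add: smooth_intros)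
  have d: "partial (v, 0) ?\<Phi> (x, r) = p r * fourier (\<lambda>w. partial (v, 0) H (x, w)) (r *\<^sub>R \<xi>)" for r
  proof -
    have "smooth (\<lambda>x. fourier (\<lambda>w. H (x, w)) (r *\<^sub>R \<xi>))"
      using smooth_slice(1)[OF smooth_fourier[OF assms(2,3)]] by simp
    from has_derivative_mult_right[OF smooth_has_derivative[OF this], of "p r"]
    have "((\<lambda>x. ?\<Phi> (x, r)) has_derivative
        (\<lambda>v. p r * fourier (\<lambda>w. partial (v, 0) H (x, w)) (r *\<^sub>R \<xi>))) (at x)"
      by (simp add: partial_fourier_parameter[OF assms(2,3)])
    from partial_fst_eqI[OF s this] show ?thesis .
  qed
  have "((\<lambda>x. radial_symbol p H x \<xi>) has_derivative
      (\<lambda>v. integral (cbox 0 1) (\<lambda>r. partial (v, 0) ?\<Phi> (x, r)))) (at x)"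
    using has_derivative_integral_cbox[OF s, of 0 1 x] by (simp add: radial_symbol_eq_integral[OF assms])
  then have "partial v (\<lambda>x. radial_symbol p H x \<xi>) x = integral (cbox 0 1) (\<lambda>r. partial (v, 0) ?\<Phi> (x, r))"
    by (rule partial_eqI)
  also have "\<dots> = radial_symbol p (partial (v, 0) H) x \<xi>"
    unfolding d
    by (subst radial_symbol_eq_integral[OF assms(1) smooth_partial[OF assms(2)] properly_supported_partial[OF assms(3)]]) simp
  finally show "partial v (\<lambda>x. radial_symbol p H x \<xi>) x = radial_symbol p (partial (v, 0) H) x \<xi>" .
qed

text \<open>
  A derivative in \<open>\<xi>\<close> of \<open>h(x, r \<xi>)\<close> yields a factor \<open>r\<close> from the dilation, and a factor linear in
  \<open>w\<close> under the Fourier integral. The factor \<open>r\<close> is the source of the gain of one order.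
\<close>

lemma partial_radial_symbol_\<xi>:
  assumes "smooth p" "smooth H" "properly_supported H"
  shows "partial v (radial_symbol p H x) =
    radial_symbol (\<lambda>r. of_real r * p r) (\<lambda>z. - (\<i> * of_real (snd z \<bullet> v)) * H z) x"
proof
  fix \<xi>
  let ?F = "fourier (\<lambda>w. H (x, w))"
  let ?\<Phi> = "\<lambda>z. p (snd z) * ?F (snd z *\<^sub>R fst z)"
  have F: "smooth ?F"
    using smooth_slice(2)[OF smooth_fourier[OF assms(2,3)], of x] by simp
  then have s: "smooth ?\<Phi>"
    by (intro smooth_intros smooth_compose[OF assms(1)] smooth_compose[OF F])
  have d: "partial (v, 0) ?\<Phi> (\<xi>, r) = of_real r * p r * fourier (\<lambda>w. - (\<i> * of_real (w \<bullet> v)) * H (x, w)) (r *\<^sub>R \<xi>)" for r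
  proof -
    have "((\<lambda>\<xi>. ?F (r *\<^sub>R \<xi>)) has_derivative
        (\<lambda>v. fourier (\<lambda>w. - (\<i> * of_real (w \<bullet> (r *\<^sub>R v))) * H (x, w)) (r *\<^sub>R \<xi>))) (at \<xi>)"
      by (rule has_derivative_compose[OF _ has_derivative_fourier[OF test_function_slice[OF assms(2,3)]]])
         (auto intro!: derivative_eq_intros)
    then have "((\<lambda>\<xi>. ?\<Phi> (\<xi>, r)) has_derivative
        (\<lambda>v. p r * fourier (\<lambda>w. - (\<i> * of_real (w \<bullet> (r *\<^sub>R v))) * H (x, w)) (r *\<^sub>R \<xi>))) (at \<xi>)"
      unfolding fst_conv snd_conv by (rule has_derivative_mult_right)
    from partial_fst_eqI[OF s this] have "partial (v, 0) ?\<Phi> (\<xi>, r) = p r * fourier (\<lambda>w. - (\<i> * of_real (w \<bullet> (r *\<^sub>R v))) * H (x, w)) (r *\<^sub>R \<xi>)" .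
    also have "fourier (\<lambda>w. - (\<i> * of_real (w \<bullet> (r *\<^sub>R v))) * H (x, w)) (r *\<^sub>R \<xi>) =
        of_real r * fourier (\<lambda>w. - (\<i> * of_real (w \<bullet> v)) * H (x, w)) (r *\<^sub>R \<xi>)"
      unfolding fourier_def integral_mult_right_zero[symmetric] by (simp add: mult_ac)
    finally show ?thesis
      by (simp add: mult_ac)
  qed
  have "((\<lambda>\<xi>. radial_symbol p H x \<xi>) has_derivative
      (\<lambda>v. integral (cbox 0 1) (\<lambda>r. partial (v, 0) ?\<Phi> (\<xi>, r)))) (at \<xi>)"
    using has_derivative_integral_cbox[OF s, of 0 1 \<xi>] by (simp add: radial_symbol_eq_integral[OF assms])
  then have "partial v (\<lambda>\<xi>. radial_symbol p H x \<xi>) \<xi> = integral (cbox 0 1) (\<lambda>r. partial (v, 0) ?\<Phi> (\<xi>, r))"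
    by (rule partial_eqI)
  also have "\<dots> = radial_symbol (\<lambda>r. of_real r * p r) (\<lambda>z. - (\<i> * of_real (snd z \<bullet> v)) * H z) x \<xi>"
  proof -
    have "smooth (\<lambda>r. of_real r * p r)" "smooth (\<lambda>z. - (\<i> * of_real (snd z \<bullet> v)) * H z)"
      "properly_supported (\<lambda>z. - (\<i> * of_real (snd z \<bullet> v)) * H z)"
      by (intro smooth_intros assms properly_supported_mult)+
    from radial_symbol_eq_integral(2)[OF this] show ?thesis
      unfolding d by simp
  qed
  finally show "partial v (radial_symbol p H x) \<xi> =
      radial_symbol (\<lambda>r. of_real r * p r) (\<lambda>z. - (\<i> * of_real (snd z \<bullet> v)) * H z) x \<xi>" .
qed

lemma foldr_partial_radial_symbol_x:
  assumes "smooth p" "smooth H" "properly_supported H"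
  shows "\<exists>H'. smooth H' \<and> properly_supported H' \<and>
    (\<forall>\<xi>. foldr partial vs (\<lambda>x. radial_symbol p H x \<xi>) = (\<lambda>x. radial_symbol p H' x \<xi>))"
proof (induction vs)
  case Nil
  then show ?case using assms by auto
next
  case (Cons v vs)
  then obtain H' where "smooth H'" "properly_supported H'"
    "\<And>\<xi>. foldr partial vs (\<lambda>x. radial_symbol p H x \<xi>) = (\<lambda>x. radial_symbol p H' x \<xi>)"
    by blast
  then show ?case
    using partial_radial_symbol_x[OF assms(1), of H' v]
    by (intro exI[of _ "partial (v, 0) H'"]) (simp add: smooth_partial properly_supported_partial)
qed

lemma foldr_partial_radial_symbol_\<xi>:
  assumes "smooth p" "smooth H" "properly_supported H"
  shows "\<exists>H'. smooth H' \<and> properly_supported H' \<and>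
    (\<forall>x. foldr partial vs (radial_symbol p H x) = radial_symbol (\<lambda>r. of_real r ^ length vs * p r) H' x)"
proof (induction vs)
  case Nil
  then show ?case using assms by auto
next
  case (Cons v vs)
  then obtain H' where H': "smooth H'" "properly_supported H'"
    "\<And>x. foldr partial vs (radial_symbol p H x) = radial_symbol (\<lambda>r. of_real r ^ length vs * p r) H' x"
    by blast
  have "smooth (\<lambda>r. of_real r ^ length vs * p r)"
    by (intro smooth_intros assms(1))
  note step = partial_radial_symbol_\<xi>[OF this H'(1,2), of v]
  let ?H = "\<lambda>z. - (\<i> * of_real (snd z \<bullet> v)) * H' z"
  have "smooth ?H"
    by (rule smooth_mult[OF _ H'(1)]) (intro smooth_intros)
  moreover have "properly_supported ?H"
    by (rule properly_supported_mult[OF H'(2)])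
  moreover have "foldr partial (v # vs) (radial_symbol p H x) =
      radial_symbol (\<lambda>r. of_real r ^ length (v # vs) * p r) ?H x" for x
    using step[of x] by (simp add: H'(3) mult.assoc)
  ultimately show ?case
    by blast
qed

text \<open>
  An antiderivative is \<open>r / (1 + r \<rho>)\<close>.
\<close>

lemma integral_inverse_square:
  fixes \<rho> :: real
  assumes "\<rho> > 0"
  shows "((\<lambda>r. inverse ((1 + r * \<rho>)\<^sup>2)) has_integral inverse (1 + \<rho>)) {0..1}"
proof -
  have "((\<lambda>r. inverse ((1 + r * \<rho>)\<^sup>2)) has_integral (1 / (1 + 1 * \<rho>) - 0 / (1 + 0 * \<rho>))) {0..1}"
  proof (rule fundamental_theorem_of_calculus)
    fix r :: real assume "r \<in> {0..1}"
    then have "1 + r * \<rho> > 0"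
      using assms by (auto intro: add_pos_nonneg)
    then show "((\<lambda>r. r / (1 + r * \<rho>)) has_vector_derivative inverse ((1 + r * \<rho>)\<^sup>2)) (at r within {0..1})"
      unfolding has_real_derivative_iff_has_vector_derivative[symmetric]
      by (auto intro!: derivative_eq_intros simp: field_simps power2_eq_square)
  qed simp
  then show ?thesis
    by (simp add: inverse_eq_divide)
qed

text \<open>
  Put \<open>\<rho> = 1 + |\<xi>|\<close>. For \<open>0 \<le> r \<le> 1\<close> the number \<open>1 + r |\<xi>|\<close> is at least \<open>r \<rho>\<close> and at least
  \<open>(1 + r \<rho>) / 2\<close>. Of the \<open>k + 2\<close> powers of decay of the Fourier transform, \<open>k\<close> turn the factor
  \<open>r\<^sup>k\<close> into \<open>\<rho>\<^sup>-\<^sup>k\<close>, and the other two leave an integrand \<open>(1 + r \<rho>)\<^sup>-\<^sup>2\<close>, whose integral contributes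
  the last factor \<open>\<rho>\<^sup>-\<^sup>1\<close>.
\<close>

lemma radial_symbol_bound:
  assumes "smooth p" "smooth H" "properly_supported H"
    and p: "\<And>r. r \<in> {0..1} \<Longrightarrow> norm (p r) \<le> A * r ^ k" and "A \<ge> 0"
  shows "\<exists>C. \<forall>x \<xi>. norm x \<le> R \<longrightarrow> norm (radial_symbol p H x \<xi>) \<le> C * (1 + norm \<xi>) powr (- 1 - real k)"
proof -
  obtain D where D: "\<And>x \<xi>. norm x \<le> R \<Longrightarrow> (1 + norm \<xi>) ^ (k + 2) * norm (fourier (\<lambda>w. H (x, w)) \<xi>) \<le> D"
    using fourier_rapid_decay[OF assms(2,3), of R "k + 2"] by blast
  have "norm (radial_symbol p H x \<xi>) \<le> 4 * A * D * (1 + norm \<xi>) powr (- 1 - real k)"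
    if x: "norm x \<le> R" for x \<xi>
  proof -
    let ?F = "fourier (\<lambda>w. H (x, w))"
    define \<rho> where "\<rho> = 1 + norm \<xi>"
    have \<rho>: "\<rho> > 0" by (simp add: \<rho>_def add_pos_nonneg)
    have D0: "D \<ge> 0"
      using order_trans[OF _ D[OF x, of 0]] by simp
    \<comment> \<open>The factor \<open>4\<close> comes from the square of \<open>1 + r \<rho> \<le> 2 (1 + r |\<xi>|)\<close>.\<close>
    let ?K = "4 * A * D * inverse (\<rho> ^ k)"
    have "norm (p r * ?F (r *\<^sub>R \<xi>)) \<le> ?K * inverse ((1 + r * \<rho>)\<^sup>2)" if r: "r \<in> {0..1}" for r
    proof -
      let ?t = "1 + r * norm \<xi>"
      have t: "?t \<ge> 1" and rn: "r * norm \<xi> \<ge> 0" using r by simp_all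
      have rt: "r * \<rho> \<le> ?t" "1 + r * \<rho> \<le> 2 * ?t"
        using r rn unfolding \<rho>_def distrib_left by (simp_all, linarith)
      have "(r * \<rho>) ^ k * (1 + r * \<rho>)\<^sup>2 \<le> ?t ^ k * (2 * ?t)\<^sup>2"
        by (intro mult_mono power_mono rt) (use r \<rho> t in auto)
      also have "\<dots> = 2\<^sup>2 * ?t ^ (k + 2)"
        by (simp only: power_mult_distrib power_add mult_ac)
      also have "\<dots> = 4 * ?t ^ (k + 2)"
        by simp
      finally have "(r * \<rho>) ^ k * (1 + r * \<rho>)\<^sup>2 * norm (?F (r *\<^sub>R \<xi>)) \<le> 4 * ?t ^ (k + 2) * norm (?F (r *\<^sub>R \<xi>))"
        by (rule mult_right_mono) simp
      also have "\<dots> \<le> 4 * D"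
        using D[OF x, of "r *\<^sub>R \<xi>"] r by simp
      finally have 1: "r ^ k * norm (?F (r *\<^sub>R \<xi>)) * (\<rho> ^ k * (1 + r * \<rho>)\<^sup>2) \<le> 4 * D"
        by (simp add: power_mult_distrib mult_ac)
      have pos: "\<rho> ^ k * (1 + r * \<rho>)\<^sup>2 > 0"
        using r \<rho> by (intro mult_pos_pos zero_less_power) (auto intro: add_pos_nonneg)
      have "norm (p r * ?F (r *\<^sub>R \<xi>)) \<le> A * (r ^ k * norm (?F (r *\<^sub>R \<xi>)))"
        using mult_right_mono[OF p[OF r]] by (simp add: norm_mult mult.assoc)
      also have "\<dots> \<le> A * (4 * D * inverse (\<rho> ^ k * (1 + r * \<rho>)\<^sup>2))"
        using 1 pos \<open>A \<ge> 0\<close> by (intro mult_left_mono) (simp_all add: divide_inverse[symmetric] pos_le_divide_eq)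
      finally show ?thesis
        by (simp add: mult_ac)
    qed
    then have "norm (radial_symbol p H x \<xi>) \<le> integral {0..1} (\<lambda>r. ?K * inverse ((1 + r * \<rho>)\<^sup>2))"
      unfolding radial_symbol_eq_integral(2)[OF assms(1-3)]
      by (intro Henstock_Kurzweil_Integration.integral_norm_bound_integral
          radial_symbol_eq_integral(1)[OF assms(1-3)]
          has_integral_integrable[OF has_integral_mult_right[OF integral_inverse_square[OF \<rho>]]])
    also have "\<dots> = ?K * inverse (1 + \<rho>)"
      using has_integral_mult_right[OF integral_inverse_square[OF \<rho>]] by (rule integral_unique)
    also have "\<dots> \<le> ?K * inverse \<rho>"
      using \<rho> \<open>A \<ge> 0\<close> D0 by (intro mult_left_mono) auto
    also have "inverse (\<rho> ^ k) * inverse \<rho> = \<rho> powr (- 1 - real k)"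
      using \<rho> by (simp add: powr_diff powr_minus powr_realpow divide_inverse mult.commute)
    then have "?K * inverse \<rho> = 4 * A * D * \<rho> powr (- 1 - real k)"
      by (simp add: mult.assoc)
    finally show ?thesis
      by (simp add: \<rho>_def)
  qed
  then show ?thesis by blast
qed

text \<open>
  Differentiating \<open>|\<beta>|\<close> times in \<open>\<xi>\<close> makes the weight \<open>O(r\<^sup>|\<^sup>\<beta>\<^sup>|)\<close>, and derivatives in \<open>x\<close> leave the
  weight as it is; so the bound for a single symbol applies to all derivatives.
\<close>

proposition radial_symbol_in_symbol_class:
  fixes H :: "(real^'n::{finite,linorder}) \<times> (real^'n::_) \<Rightarrow> complex"
  assumes "smooth p" "smooth H" "properly_supported H"
  shows "radial_symbol p H \<in> symbol_class (- 1)"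
  unfolding symbol_class_def
proof (intro CollectI conjI allI impI)
  show "smooth (\<lambda>(x, \<xi>). radial_symbol p H x \<xi>)"
    by (rule smooth_radial_symbol[OF assms])
next
  fix M :: "(real^'n::_) set" and \<alpha> \<beta> :: "nat^'n::_"
  assume "compact M"
  then obtain R where R: "\<And>x. x \<in> M \<Longrightarrow> norm x \<le> R"
    using compact_imp_bounded bounded_iff by metis
  obtain vs where vs: "\<And>f :: real^'n::_ \<Rightarrow> complex. multi_partial \<alpha> f = foldr partial vs f"
    using multi_partial_eq_foldr[of \<alpha>] by metis
  obtain ws where ws: "length ws = (\<Sum>i\<in>UNIV. \<beta> $ i)"
    "\<And>f :: real^'n::_ \<Rightarrow> complex. multi_partial \<beta> f = foldr partial ws f"
    using multi_partial_eq_foldr[of \<beta>] by metis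
  let ?k = "\<Sum>i\<in>UNIV. \<beta> $ i"
  let ?p = "\<lambda>r. of_real r ^ ?k * p r"
  have p: "smooth ?p"
    by (intro smooth_intros assms(1))
  obtain H1 where H1: "smooth H1" "properly_supported H1"
    "\<And>x. foldr partial ws (radial_symbol p H x) = radial_symbol ?p H1 x"
    using foldr_partial_radial_symbol_\<xi>[OF assms, of ws] ws(1) by metis
  obtain H2 where H2: "smooth H2" "properly_supported H2"
    "\<And>\<xi>. foldr partial vs (\<lambda>x. radial_symbol ?p H1 x \<xi>) = (\<lambda>x. radial_symbol ?p H2 x \<xi>)"
    using foldr_partial_radial_symbol_x[OF p H1(1,2), of vs] by metis
  have "bounded (p ` {0..1})"
    by (intro compact_imp_bounded compact_continuous_image smooth_continuous_on assms(1)) auto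
  then obtain A where A: "A > 0" "\<And>r. r \<in> {0..1} \<Longrightarrow> norm (p r) \<le> A"
    by (auto simp: bounded_pos)
  have "norm (?p r) \<le> A * r ^ ?k" if "r \<in> {0..1}" for r
    using mult_left_mono[OF A(2)[OF that], of "r ^ ?k"] that by (simp add: norm_mult norm_power mult.commute)
  from radial_symbol_bound[OF p H2(1,2) this less_imp_le[OF A(1)], of R]
  obtain C where "\<And>x \<xi>. norm x \<le> R \<Longrightarrow> norm (radial_symbol ?p H2 x \<xi>) \<le> C * (1 + norm \<xi>) powr (- 1 - real ?k)"
    by blast
  then show "\<exists>C. \<forall>x\<in>M. \<forall>\<xi>. norm (multi_partial \<alpha> (\<lambda>x'. multi_partial \<beta> (radial_symbol p H x') \<xi>) x)
      \<le> C * (1 + norm \<xi>) powr (- 1 - real ?k)"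
    unfolding vs ws(2) H1(3) H2(3) using R by blast
qed

text \<open>
  After Fubini the integral over \<open>\<xi>\<close> is that of \<open>exp (\<i> \<langle>\<xi>, x - r w\<rangle>)\<close> times the Fourier transform of
  \<open>f\<close>, and Fourier inversion turns it into \<open>f(x - r w)\<close>.
\<close>

section \<open>The operator of a radially averaged symbol\<close>

proposition symbol_op_radial_symbol:
  fixes H :: "(real^'n::{finite,linorder}) \<times> (real^'n::_) \<Rightarrow> complex"
  assumes p: "smooth p" and H: "smooth H" "properly_supported H" and f: "f \<in> test_functions"
  shows "symbol_op (radial_symbol p H) f x =
    (LINT r:{0..1}|lborel. p r * (LINT w|lborel. H (x, w) * f (x - r *\<^sub>R w)))"
proof -
  let ?E = "\<lambda>\<xi>. exp (\<i> * of_real (\<xi> \<bullet> x))"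
  let ?F = "fourier (\<lambda>w. H (x, w))"
  let ?c = "(2 * of_real pi) ^ CARD('n) :: complex"
  let ?P = "\<lambda>r. indicator {0..1} r *\<^sub>R p r"
  have Hx: "(\<lambda>w. H (x, w)) \<in> test_functions"
    by (rule test_function_slice[OF H])
  have F: "smooth ?F"
    using smooth_slice(2)[OF smooth_fourier[OF H], of x] by simp
  obtain C where C: "\<And>\<xi>. norm (?F \<xi>) \<le> C"
    using fourier_rapid_decay[OF H, of "norm x" 0] by auto
  note fi = fourier_integrable[OF f]
  have Pi: "integrable lborel ?P"
    using set_lebesgue_integral_cbox(1)[OF smooth_continuous_on[OF p], of 0 1] by (simp add: set_integrable_def)
  have mE: "smooth (\<lambda>z :: (real^'n::_) \<times> real. ?E (fst z) * ?F (snd z *\<^sub>R fst z))"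
    by (intro smooth_mult smooth_exp smooth_const smooth_compose[OF F])
       (intro smooth_mult smooth_const smooth_of_real smooth_inner smooth_fst smooth_snd smooth_id smooth_scaleR)+
  have mw: "smooth (\<lambda>z. ?E (fst z) * wave (r *\<^sub>R fst z) (snd z))" for r
    by (intro smooth_intros)
  have inner: "(LINT \<xi>|lborel. ?E \<xi> * ?F (r *\<^sub>R \<xi>) * fourier f \<xi>) =
      ?c * (LINT w|lborel. H (x, w) * f (x - r *\<^sub>R w))" for r
  proof -
    have "(LINT \<xi>|lborel. ?E \<xi> * ?F (r *\<^sub>R \<xi>) * fourier f \<xi>) =
        (LINT \<xi>|lborel. LINT w|lborel. (?E \<xi> * wave (r *\<^sub>R \<xi>) w) * fourier f \<xi> * H (x, w))"
    proof (rule Bochner_Integration.integral_cong[OF refl])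
      fix \<xi>
      have "(LINT w|lborel. (?E \<xi> * wave (r *\<^sub>R \<xi>) w) * fourier f \<xi> * H (x, w)) =
          (LINT w|lborel. ?E \<xi> * fourier f \<xi> * (wave (r *\<^sub>R \<xi>) w * H (x, w)))"
        by (simp only: mult_ac)
      also have "\<dots> = ?E \<xi> * fourier f \<xi> * ?F (r *\<^sub>R \<xi>)"
        unfolding fourier_def by (rule integral_mult_right_zero)
      finally show "?E \<xi> * ?F (r *\<^sub>R \<xi>) * fourier f \<xi> =
          (LINT w|lborel. (?E \<xi> * wave (r *\<^sub>R \<xi>) w) * fourier f \<xi> * H (x, w))"
        by (simp only: mult_ac)
    qed
    also have "\<dots> = (LINT w|lborel. LINT \<xi>|lborel. (?E \<xi> * wave (r *\<^sub>R \<xi>) w) * fourier f \<xi> * H (x, w))"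
    proof (rule Fubini_bounded_product[OF _ _ fi test_function_integrable[OF Hx]])
      show "(\<lambda>(\<xi>, w). ?E \<xi> * wave (r *\<^sub>R \<xi>) w) \<in> borel_measurable borel"
        using smooth_measurable[OF mw[of r]] by (simp add: case_prod_unfold)
      show "norm (?E \<xi> * wave (r *\<^sub>R \<xi>) w) \<le> 1" for \<xi> w
        by (simp add: norm_mult)
    qed
    also have "\<dots> = (LINT w|lborel. ?c * (H (x, w) * f (x - r *\<^sub>R w)))"
    proof (rule Bochner_Integration.integral_cong[OF refl])
      fix w
      have E: "?E \<xi> * wave (r *\<^sub>R \<xi>) w = exp (\<i> * of_real (\<xi> \<bullet> (x - r *\<^sub>R w)))" for \<xi>
        by (simp add: exp_add[symmetric] inner_diff_right algebra_simps)
      have "(LINT \<xi>|lborel. (?E \<xi> * wave (r *\<^sub>R \<xi>) w) * fourier f \<xi> * H (x, w)) =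
          (LINT \<xi>|lborel. exp (\<i> * of_real (\<xi> \<bullet> (x - r *\<^sub>R w))) * fourier f \<xi>) * H (x, w)"
        unfolding E by (rule integral_mult_left_zero)
      also have "\<dots> = ?c * (H (x, w) * f (x - r *\<^sub>R w))"
        using fourier_inversion[OF f, of "x - r *\<^sub>R w"] by simp
      finally show "(LINT \<xi>|lborel. (?E \<xi> * wave (r *\<^sub>R \<xi>) w) * fourier f \<xi> * H (x, w)) =
          ?c * (H (x, w) * f (x - r *\<^sub>R w))" .
    qed
    also have "\<dots> = ?c * (LINT w|lborel. H (x, w) * f (x - r *\<^sub>R w))"
      by (rule integral_mult_right_zero)
    finally show ?thesis .
  qed
  have "(LINT \<xi>|lborel. ?E \<xi> * radial_symbol p H x \<xi> * fourier f \<xi>) =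
      (LINT \<xi>|lborel. LINT r|lborel. (?E \<xi> * ?F (r *\<^sub>R \<xi>)) * fourier f \<xi> * ?P r)"
  proof (rule Bochner_Integration.integral_cong[OF refl])
    fix \<xi>
    have "(LINT r|lborel. (?E \<xi> * ?F (r *\<^sub>R \<xi>)) * fourier f \<xi> * ?P r) =
        (LINT r|lborel. ?E \<xi> * fourier f \<xi> * (indicator {0..1} r *\<^sub>R (p r * ?F (r *\<^sub>R \<xi>))))"
      by (simp add: mult_ac)
    also have "\<dots> = ?E \<xi> * fourier f \<xi> * radial_symbol p H x \<xi>"
      unfolding radial_symbol_def set_lebesgue_integral_def by (rule integral_mult_right_zero)
    finally show "?E \<xi> * radial_symbol p H x \<xi> * fourier f \<xi> =
        (LINT r|lborel. (?E \<xi> * ?F (r *\<^sub>R \<xi>)) * fourier f \<xi> * ?P r)"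
      by (simp only: mult_ac)
  qed
  also have "\<dots> = (LINT r|lborel. LINT \<xi>|lborel. (?E \<xi> * ?F (r *\<^sub>R \<xi>)) * fourier f \<xi> * ?P r)"
  proof (rule Fubini_bounded_product[OF _ _ fi Pi])
    show "(\<lambda>(\<xi>, r). ?E \<xi> * ?F (r *\<^sub>R \<xi>)) \<in> borel_measurable borel"
      using smooth_measurable[OF mE] by (simp add: case_prod_unfold)
    show "norm (?E \<xi> * ?F (r *\<^sub>R \<xi>)) \<le> C" for \<xi> r
      using C by (simp add: norm_mult)
  qed
  also have "\<dots> = (LINT r|lborel. ?c * (indicator {0..1} r *\<^sub>R (p r * (LINT w|lborel. H (x, w) * f (x - r *\<^sub>R w)))))"
    unfolding integral_mult_left_zero inner by (simp add: mult_ac)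
  also have "\<dots> = ?c * (LINT r:{0..1}|lborel. p r * (LINT w|lborel. H (x, w) * f (x - r *\<^sub>R w)))"
    unfolding set_lebesgue_integral_def by (rule integral_mult_right_zero)
  finally show ?thesis
    by (simp add: symbol_op_def)
qed

text \<open>
  The interval \<open>{1..}\<close> corresponds to \<open>{0<..1}\<close>, which differs from \<open>{0..1}\<close> by a null set.
\<close>

lemma integral_inverse_substitution:
  fixes \<phi> :: "real \<Rightarrow> 'a::euclidean_space"
  assumes meas: "\<phi> \<in> borel_measurable borel" and int: "set_integrable lborel {0..1} \<phi>"
  shows "set_integrable lborel {1..} (\<lambda>t. inverse (t\<^sup>2) *\<^sub>R \<phi> (inverse t))"
    and "(LINT t:{1..}|lborel. inverse (t\<^sup>2) *\<^sub>R \<phi> (inverse t)) = (LINT r:{0..1}|lborel. \<phi> r)"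
proof -
  let ?\<psi> = "\<lambda>t. inverse (t\<^sup>2) *\<^sub>R \<phi> (inverse t)"
  have img: "inverse ` {1..} = {0<..1::real}"
  proof
    show "inverse ` {1..} \<subseteq> {0<..1::real}"
      by (auto simp: inverse_le_1_iff)
    show "{0<..1::real} \<subseteq> inverse ` {1..}"
    proof
      fix r :: real assume "r \<in> {0<..1}"
      then have "inverse r \<in> {1..}" "r = inverse (inverse r)"
        by (auto simp: one_le_inverse_iff)
      then show "r \<in> inverse ` {1..}" by blast
    qed
  qed
  have m: "(\<lambda>r. indicator {0<..1} r *\<^sub>R \<phi> r) \<in> borel_measurable borel"
    "(\<lambda>t. indicator {1..} t *\<^sub>R ?\<psi> t) \<in> borel_measurable borel"
    using meas by measurable
  have int': "set_integrable lborel {0<..1} \<phi>"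
    by (rule set_integrable_subset[OF int]) auto
  then have ai: "\<phi> absolutely_integrable_on {0<..1}"
    using m(1) by (simp add: set_integrable_def integrable_completion)
  have der: "(inverse has_field_derivative - inverse (t\<^sup>2)) (at t within {1..})" if "t \<in> {1..}" for t :: real
    using that by (auto intro!: derivative_eq_intros simp: power2_eq_square)
  have inj: "inj_on inverse {1::real..}"
    by (auto intro: inj_onI)
  have "?\<psi> absolutely_integrable_on {1..} \<and> integral {1..} ?\<psi> = integral {0<..1} \<phi>"
    using has_absolute_integral_change_of_variables_real[OF _ der inj, of \<phi> "integral {0<..1} \<phi>"] ai
    by (simp add: img)
  then have ai': "?\<psi> absolutely_integrable_on {1..}" and eq: "integral {1..} ?\<psi> = integral {0<..1} \<phi>"
    by blast+
  show 1: "set_integrable lborel {1..} ?\<psi>"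
    using ai' m(2) by (simp add: set_integrable_def integrable_completion)
  have "(LINT t:{1..}|lborel. ?\<psi> t) = (LINT r:{0<..1}|lborel. \<phi> r)"
    using set_borel_integral_eq_integral(2)[OF 1] set_borel_integral_eq_integral(2)[OF int'] eq by simp
  also have "\<dots> = (LINT r:{0..1}|lborel. \<phi> r)"
    unfolding set_lebesgue_integral_def
  proof (rule integral_cong_AE)
    show "AE r in lborel. indicator {0<..1} r *\<^sub>R \<phi> r = indicator {0..1} r *\<^sub>R \<phi> r"
      using AE_lborel_singleton[of "0::real"] by eventually_elim (auto simp: indicator_def)
  qed (use meas in measurable)
  finally show "(LINT t:{1..}|lborel. ?\<psi> t) = (LINT r:{0..1}|lborel. \<phi> r)" .
qed


section \<open>Weakly singular kernels given by integrals along rays\<close>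

lemma linear_times_translate:
  fixes \<theta> :: "'a::euclidean_space \<Rightarrow> complex"
  assumes \<theta>: "\<theta> \<in> test_functions" and \<sigma>: "\<sigma> \<noteq> 0"
  shows "smooth (\<lambda>z. of_real (e \<bullet> snd z) * \<theta> (fst z + \<sigma> *\<^sub>R snd z))"
    and "properly_supported (\<lambda>z. of_real (e \<bullet> snd z) * \<theta> (fst z + \<sigma> *\<^sub>R snd z))"
proof -
  show "smooth (\<lambda>z. of_real (e \<bullet> snd z) * \<theta> (fst z + \<sigma> *\<^sub>R snd z))"
    by (intro smooth_mult smooth_compose[OF test_functionD(1)[OF \<theta>]]) (intro smooth_intros)+
  obtain a where a: "\<And>t. t \<notin> cbox (- a) a \<Longrightarrow> \<theta> t = 0"
    using test_functionD(2)[OF \<theta>] by blast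
  obtain B where B: "\<And>t. t \<in> cbox (- a) a \<Longrightarrow> norm t \<le> B"
    using bounded_cbox[of "- a" a] by (auto simp: bounded_iff)
  show "properly_supported (\<lambda>z. of_real (e \<bullet> snd z) * \<theta> (fst z + \<sigma> *\<^sub>R snd z))"
  proof (rule properly_supported_mult, unfold properly_supported_def, intro allI exI impI)
    fix R and p t :: 'a
    \<comment> \<open>As \<open>\<theta>\<close> vanishes outside the ball of radius \<open>B\<close>, the bound makes \<open>|\<sigma> t| - |p|\<close> exceed \<open>B\<close>.\<close>
    assume p: "norm p \<le> R" and t: "(B + R) / \<bar>\<sigma>\<bar> < norm t"
    have "norm (\<sigma> *\<^sub>R t) \<le> norm (p + \<sigma> *\<^sub>R t) + norm p"
      using norm_triangle_ineq4[of "p + \<sigma> *\<^sub>R t" p] by simp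
    moreover have "B + R < norm (\<sigma> *\<^sub>R t)"
      using t \<sigma> by (simp add: pos_divide_less_eq mult.commute)
    ultimately have "B < norm (p + \<sigma> *\<^sub>R t)"
      using p by linarith
    then show "\<theta> (fst (p, t) + \<sigma> *\<^sub>R snd (p, t)) = 0"
      using a[of "p + \<sigma> *\<^sub>R t"] B[of "p + \<sigma> *\<^sub>R t"] by fastforce
  qed
qed

text \<open>
  This is the integral of \<open>\<theta>\<close>, with a weight of order \<open>t\<^sup>n\<^sup>-\<^sup>1\<close>, along the ray from \<open>x + \<sigma> z\<close> in the
  direction \<open>\<sigma> z\<close>. It may blow up like \<open>|z|\<^sup>-\<^sup>n\<close> at \<open>z = 0\<close>. Writing the weight as
  \<open>t\<^sup>n\<^sup>-\<^sup>1 p(1 / t)\<close> makes \<open>p\<close> the weight of the symbol.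
\<close>

definition radial_kernel ::
    "(real \<Rightarrow> complex) \<Rightarrow> real \<Rightarrow> ('a::euclidean_space \<Rightarrow> complex) \<Rightarrow> 'a \<Rightarrow> 'a \<Rightarrow> complex" where
  "radial_kernel p \<sigma> \<theta> x z =
     (LINT t:{1..}|lborel. of_real (t ^ (DIM('a) - 1)) * p (inverse t) * \<theta> (x + (\<sigma> * t) *\<^sub>R z))"

text \<open>
  For fixed \<open>t\<close>, substitute \<open>z = w / t\<close>. The Jacobian \<open>t\<^sup>-\<^sup>n\<close> and the factor \<open>1 / t\<close> from \<open>\<langle>e, z\<rangle>\<close> turn
  the weight \<open>t\<^sup>n\<^sup>-\<^sup>1\<close> into \<open>t\<^sup>-\<^sup>2\<close>, which is the Jacobian of \<open>r = 1 / t\<close>. The same computation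
  with absolute values bounds the inner integrals by a multiple of the integrable function \<open>t\<^sup>-\<^sup>2\<close>,
  which justifies the interchange of the integrals and shows that the singularity of the kernel is
  integrable.
\<close>

proposition radial_kernel_integral:
  fixes \<theta> f :: "'a::euclidean_space \<Rightarrow> complex" and e :: 'a
  assumes p: "smooth p" and \<theta>: "\<theta> \<in> test_functions" and f: "f \<in> test_functions" and \<sigma>: "\<sigma> \<noteq> 0"
  defines "H \<equiv> \<lambda>z. of_real (e \<bullet> snd z) * \<theta> (fst z + \<sigma> *\<^sub>R snd z)"
  shows "integrable lborel (\<lambda>y. radial_kernel p \<sigma> \<theta> x (x - y) * of_real (e \<bullet> (x - y)) * f y)"
    and "(LINT y|lborel. radial_kernel p \<sigma> \<theta> x (x - y) * of_real (e \<bullet> (x - y)) * f y) =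
      (LINT r:{0..1}|lborel. p r * (LINT w|lborel. H (x, w) * f (x - r *\<^sub>R w)))"
proof -
  note H = linear_times_translate[OF \<theta> \<sigma>, of e, folded H_def]
  have Hx: "(\<lambda>w. H (x, w)) \<in> test_functions"
    by (rule test_function_slice[OF H])
  let ?M = "\<lambda>r. LINT w|lborel. H (x, w) * f (x - r *\<^sub>R w)"
  let ?Q = "\<lambda>t z. of_real (t ^ (DIM('a) - 1)) * p (inverse t) * (of_real (e \<bullet> z) * \<theta> (x + (\<sigma> * t) *\<^sub>R z) * f (x - z))"
  have [measurable]: "p \<in> borel_measurable borel" "\<theta> \<in> borel_measurable borel" "f \<in> borel_measurable borel"
    by (intro smooth_measurable p test_functionD(1) \<theta> f)+
  have smM: "smooth ?M"
  proof -
    let ?\<Phi> = "\<lambda>z :: real \<times> 'a. f (x - fst z *\<^sub>R snd z) * H (x, snd z)"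
    have "smooth (\<lambda>z :: real \<times> 'a. f (x - fst z *\<^sub>R snd z))"
      by (intro smooth_compose[OF test_functionD(1)[OF f]] smooth_intros)
    then have "smooth ?\<Phi>"
      by (rule smooth_mult) (rule test_function_properly_supported(1)[OF Hx])
    moreover have "properly_supported ?\<Phi>"
      by (rule properly_supported_mult) (rule test_function_properly_supported(2)[OF Hx])
    ultimately have "smooth (\<lambda>r. LINT w|lborel. ?\<Phi> (r, w))"
      by (rule smooth_integral_properly_supported)
    then show ?thesis
      by (simp add: mult.commute)
  qed
  have sm: "smooth (\<lambda>r. p r * ?M r)"
    by (rule smooth_mult[OF p smM])
  have si: "set_integrable lborel {0..1} (\<lambda>r. p r * ?M r)"
    using set_lebesgue_integral_cbox(1)[OF smooth_continuous_on[OF sm], of 0 1] by simp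
  obtain B where B: "\<And>y. norm (f y) \<le> B" "B \<ge> 0"
    using test_function_bounded[OF f] by blast
  have "bounded (p ` {0..1})"
    by (intro compact_imp_bounded compact_continuous_image smooth_continuous_on p) auto
  then obtain A where A: "A > 0" "\<And>r. r \<in> {0..1} \<Longrightarrow> norm (p r) \<le> A"
    by (auto simp: bounded_pos)
  let ?D = "A * (B * (LINT w|lborel. norm (H (x, w))))"
  have Hs: "H (x, t *\<^sub>R z) = of_real t * (of_real (e \<bullet> z) * \<theta> (x + (\<sigma> * t) *\<^sub>R z))" for t z
    by (simp add: H_def)
  have scale: "t ^ DIM('a) * t = t\<^sup>2 * t ^ (DIM('a) - 1)" for t :: real
  proof -
    have "DIM('a) = Suc (DIM('a) - 1)"
      using DIM_positive[where 'a = 'a] by simp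
    then have "t ^ DIM('a) = t * t ^ (DIM('a) - 1)"
      by (metis power_Suc)
    then show ?thesis
      by (simp add: power2_eq_square)
  qed
  have Q: "(LINT z|lborel. ?Q t z) = inverse (t\<^sup>2) *\<^sub>R (p (inverse t) * ?M (inverse t))" if "t \<ge> 1" for t
  proof -
    have "?M (inverse t) = t ^ DIM('a) *\<^sub>R (LINT z|lborel. of_real t * (of_real (e \<bullet> z) * \<theta> (x + (\<sigma> * t) *\<^sub>R z) * f (x - z)))"
      using that by (subst integral_affine[where c = t and t = 0]) (simp_all add: Hs mult.assoc)
    also have "\<dots> = of_real (t ^ DIM('a) * t) * (LINT z|lborel. of_real (e \<bullet> z) * \<theta> (x + (\<sigma> * t) *\<^sub>R z) * f (x - z))"
      unfolding integral_mult_right_zero by (simp add: scaleR_conv_of_real)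
    also have "of_real (t ^ DIM('a) * t) = (of_real (t\<^sup>2) * of_real (t ^ (DIM('a) - 1)) :: complex)"
      unfolding scale by simp
    finally have "inverse (t\<^sup>2) *\<^sub>R (p (inverse t) * ?M (inverse t)) =
        of_real (t ^ (DIM('a) - 1)) * p (inverse t) * (LINT z|lborel. of_real (e \<bullet> z) * \<theta> (x + (\<sigma> * t) *\<^sub>R z) * f (x - z))"
      using that by (simp add: scaleR_conv_of_real)
    then show ?thesis
      unfolding integral_mult_right_zero by simp
  qed
  have Qi: "integrable lborel (?Q t)" for t
  proof -
    have "smooth (\<lambda>z. of_real (t ^ (DIM('a) - 1)) * p (inverse t) * (of_real (e \<bullet> z) * \<theta> (x + (\<sigma> * t) *\<^sub>R z)))"
      by (intro smooth_mult smooth_compose[OF test_functionD(1)[OF \<theta>]]) (intro smooth_intros)+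
    from test_function_integrable[OF test_function_mult[OF this test_function_reflect[OF f, of x]]]
    show ?thesis
      by (simp add: mult.assoc)
  qed
  have Qn: "(LINT z|lborel. norm (?Q t z)) \<le> inverse (t\<^sup>2) * ?D" if t: "t \<ge> 1" for t
  proof -
    have "(LINT w|lborel. norm (H (x, w))) =
        t ^ DIM('a) *\<^sub>R (LINT z|lborel. t * norm (of_real (e \<bullet> z) * \<theta> (x + (\<sigma> * t) *\<^sub>R z)))"
      using t by (subst integral_affine[where c = t and t = 0]) (simp_all add: Hs norm_mult)
    also have "\<dots> = (t\<^sup>2 * t ^ (DIM('a) - 1)) * (LINT z|lborel. norm (of_real (e \<bullet> z) * \<theta> (x + (\<sigma> * t) *\<^sub>R z)))"
      unfolding integral_mult_right_zero scale[symmetric] by simp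
    finally have L: "inverse (t\<^sup>2) * (LINT w|lborel. norm (H (x, w))) =
        t ^ (DIM('a) - 1) * (LINT z|lborel. norm (of_real (e \<bullet> z) * \<theta> (x + (\<sigma> * t) *\<^sub>R z)))"
      using t by simp
    have "integrable lborel (\<lambda>z. H (x, t *\<^sub>R z))"
      using integrable_affine[of t "\<lambda>w. H (x, w)" 0] test_function_integrable[OF Hx] t by simp
    then have "integrable lborel (\<lambda>z. inverse (of_real t) * H (x, t *\<^sub>R z))"
      by (rule integrable_mult_right)
    then have i: "integrable lborel (\<lambda>z. of_real (e \<bullet> z) * \<theta> (x + (\<sigma> * t) *\<^sub>R z))"
      using t by (simp add: Hs mult.assoc[symmetric])
    have "inverse t \<in> {0..1}"
      using t by (auto simp: inverse_le_1_iff)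
    note pA = A(2)[OF this]
    have "(LINT z|lborel. norm (?Q t z)) \<le>
        (LINT z|lborel. t ^ (DIM('a) - 1) * A * B * norm (of_real (e \<bullet> z) * \<theta> (x + (\<sigma> * t) *\<^sub>R z)))"
    proof (intro integral_mono integrable_norm[OF Qi] integrable_mult_right integrable_norm[OF i])
      fix z
      have "norm (?Q t z) = t ^ (DIM('a) - 1) * norm (p (inverse t)) * norm (f (x - z)) *
          norm (of_real (e \<bullet> z) * \<theta> (x + (\<sigma> * t) *\<^sub>R z))"
        using t by (simp add: norm_mult norm_power mult_ac)
      also have "\<dots> \<le> t ^ (DIM('a) - 1) * A * B * norm (of_real (e \<bullet> z) * \<theta> (x + (\<sigma> * t) *\<^sub>R z))"
        using t A(1) B by (intro mult_right_mono mult_mono mult_left_mono pA) auto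
      finally show "norm (?Q t z) \<le> t ^ (DIM('a) - 1) * A * B * norm (of_real (e \<bullet> z) * \<theta> (x + (\<sigma> * t) *\<^sub>R z))" .
    qed
    also have "\<dots> = inverse (t\<^sup>2) * ?D"
      unfolding integral_mult_right_zero using L by (simp add: mult_ac)
    finally show ?thesis .
  qed
  let ?q = "\<lambda>t z. indicator {1..} t *\<^sub>R ?Q t z"
  have D: "integrable lborel (\<lambda>t. indicator {1..} t *\<^sub>R (inverse (t\<^sup>2) *\<^sub>R ?D))"
    using integral_inverse_substitution(1)[of "\<lambda>_. ?D"] set_lebesgue_integral_cbox(1)[of 0 1 "\<lambda>_. ?D"]
    by (simp add: set_integrable_def)
  have int: "integrable (lborel \<Otimes>\<^sub>M lborel) (\<lambda>(t, z). ?q t z)"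
  proof (rule lborel_pair.Fubini_integrable)
    show "(\<lambda>(t, z). ?q t z) \<in> borel_measurable (lborel \<Otimes>\<^sub>M lborel)"
      by measurable
    show "AE t in lborel. integrable lborel (\<lambda>z. case (t, z) of (t, z) \<Rightarrow> ?q t z)"
      using Qi by simp
    show "integrable lborel (\<lambda>t. LINT z|lborel. norm (case (t, z) of (t, z) \<Rightarrow> ?q t z))"
    proof (rule Bochner_Integration.integrable_bound[OF D])
      show "(\<lambda>t. LINT z|lborel. norm (case (t, z) of (t, z) \<Rightarrow> ?q t z)) \<in> borel_measurable lborel"
        by measurable
      have "norm (LINT z|lborel. norm (?q t z)) \<le> norm (indicator {1..} t *\<^sub>R (inverse (t\<^sup>2) *\<^sub>R ?D))" for t
        using Qn[of t] by (cases "t \<ge> 1") (auto intro: order_trans[OF _ abs_ge_self])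
      then show "AE t in lborel. norm (LINT z|lborel. norm (case (t, z) of (t, z) \<Rightarrow> ?q t z))
          \<le> norm (indicator {1..} t *\<^sub>R (inverse (t\<^sup>2) *\<^sub>R ?D))"
        by simp
    qed
  qed
  have K: "(LINT t|lborel. ?q t z) = radial_kernel p \<sigma> \<theta> x z * of_real (e \<bullet> z) * f (x - z)" for z
  proof -
    have "(LINT t|lborel. ?q t z) = (LINT t|lborel. (indicator {1..} t *\<^sub>R
        (of_real (t ^ (DIM('a) - 1)) * p (inverse t) * \<theta> (x + (\<sigma> * t) *\<^sub>R z))) * (of_real (e \<bullet> z) * f (x - z)))"
      by (simp add: mult_ac)
    also have "\<dots> = radial_kernel p \<sigma> \<theta> x z * (of_real (e \<bullet> z) * f (x - z))"
      unfolding radial_kernel_def set_lebesgue_integral_def by (rule integral_mult_left_zero)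
    finally show ?thesis
      by (simp add: mult.assoc)
  qed
  let ?k = "\<lambda>y. radial_kernel p \<sigma> \<theta> x (x - y) * of_real (e \<bullet> (x - y)) * f y"
  have "integrable lborel (\<lambda>z. ?k (x + (- 1) *\<^sub>R z))"
    using lborel_pair.integrable_snd[OF int] unfolding K by simp
  then show "integrable lborel ?k"
    by (subst (asm) integrable_affine) simp
  have "(LINT y|lborel. ?k y) = (LINT z|lborel. ?k (x + (- 1) *\<^sub>R z))"
    by (subst integral_affine[where c = "- 1" and t = x]) simp_all
  also have "\<dots> = (LINT z|lborel. LINT t|lborel. ?q t z)"
    unfolding K by simp
  also have "\<dots> = (LINT t|lborel. LINT z|lborel. ?q t z)"
    by (rule lborel_pair.Fubini_integral[OF int])
  also have "\<dots> = (LINT t:{1..}|lborel. inverse (t\<^sup>2) *\<^sub>R (p (inverse t) * ?M (inverse t)))"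
    unfolding set_lebesgue_integral_def
  proof (rule Bochner_Integration.integral_cong[OF refl])
    fix t :: real
    show "(LINT z|lborel. ?q t z) = indicator {1..} t *\<^sub>R (inverse (t\<^sup>2) *\<^sub>R (p (inverse t) * ?M (inverse t)))"
      using Q[of t] by (cases "t \<ge> 1") auto
  qed
  also have "\<dots> = (LINT r:{0..1}|lborel. p r * ?M r)"
    by (rule integral_inverse_substitution(2)[OF smooth_measurable[OF sm] si])
  finally show "(LINT y|lborel. ?k y) = (LINT r:{0..1}|lborel. p r * ?M r)" .
qed

lemma pseudodiff_op_radial_kernel:
  fixes \<theta> :: "real^'n::{finite,linorder} \<Rightarrow> complex" and e :: "real^'n::_"
  assumes p: "smooth p" and \<theta>: "\<theta> \<in> test_functions" and \<sigma>: "\<sigma> \<noteq> 0" and k: "smooth (\<lambda>(x, y). k x y)"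
    and P: "\<And>f x. f \<in> test_functions \<Longrightarrow> P f x =
      (LINT y|lborel. radial_kernel p \<sigma> \<theta> x (x - y) * of_real (e \<bullet> (x - y)) * f y) + kernel_op k f x"
  shows "pseudodiff_op (- 1) P"
proof -
  let ?H = "\<lambda>z. of_real (e \<bullet> snd z) * \<theta> (fst z + \<sigma> *\<^sub>R snd z)"
  note H = linear_times_translate[OF \<theta> \<sigma>, of e]
  have "P f x = symbol_op (radial_symbol p ?H) f x + kernel_op k f x" if f: "f \<in> test_functions" for f x
    unfolding P[OF f] radial_kernel_integral(2)[OF p \<theta> f \<sigma>] symbol_op_radial_symbol[OF p H f] ..
  then show ?thesis
    unfolding pseudodiff_op_def using radial_symbol_in_symbol_class[OF p H] k by blast
qed

text \<open>
  For \<open>J = K \<union> {j}\<close> with \<open>j \<notin> K\<close> this is the \<open>j\<close>-th basis vector up to a sign, otherwise it is \<open>0\<close>.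
  Describing the matrix entries of contractions by inner products with a vector avoids
  a distinction of cases.
\<close>

section \<open>Matrix entries of contractions\<close>

definition contraction_covector :: "'n::{finite,linorder} set \<Rightarrow> 'n set \<Rightarrow> real^'n::{finite,linorder}" where
  "contraction_covector K J = (\<Sum>j | j \<in> J \<and> J - {j} = K. (- 1) ^ card {i\<in>J. i < j} *\<^sub>R axis j 1)"

lemma contract_dx_nth: "contract_dx v J $ K = of_real (contraction_covector K J \<bullet> v)"
proof -
  have "contract_dx v J $ K =
      (\<Sum>j\<in>J. if J - {j} = K then (- 1) ^ card {i\<in>J. i < j} * of_real (v $ j) else 0)"
    unfolding contract_dx_def sum_component by (intro sum.cong) (auto simp: axis_def)
  also have "\<dots> = (\<Sum>j | j \<in> J \<and> J - {j} = K. (- 1) ^ card {i\<in>J. i < j} * of_real (v $ j))"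
    by (simp add: sum.inter_filter)
  also have "\<dots> = of_real (contraction_covector K J \<bullet> v)"
    unfolding contraction_covector_def inner_sum_left by (simp add: inner_axis' of_real_sum)
  finally show ?thesis .
qed

lemma contraction_covector_eq_0:
  assumes "card J \<noteq> Suc (card K)"
  shows "contraction_covector K J = 0"
proof -
  have "card J = Suc (card (J - {j}))" if "j \<in> J" for j
    using that by (intro card.remove) auto
  then have "{j. j \<in> J \<and> J - {j} = K} = {}"
    using assms by blast
  then show ?thesis
    unfolding contraction_covector_def by (simp only: sum.empty)
qed

lemma contract_nth: "contract v w $ K = (\<Sum>J\<in>UNIV. of_real (contraction_covector K J \<bullet> v) * w $ J)"
  unfolding contract_def sum_component by (simp add: contract_dx_nth mult.commute)

text \<open>
  All matrix entries are of the form \<open>f \<mapsto> \<integral> G(x, y) \<langle>e, x - y\<rangle> f(y) dy\<close>. Integrability is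
  needed for the first half of the definition: it allows the vector-valued integral to be
  evaluated entry by entry.
\<close>

lemma pseudodiff_form_op_contraction:
  fixes G :: "real^'n::{finite,linorder} \<Rightarrow> real^'n::_ \<Rightarrow> complex"
  assumes int: "\<And>e f x. f \<in> test_functions \<Longrightarrow> integrable lborel (\<lambda>y. G x y * of_real (e \<bullet> (x - y)) * f y)"
    and pseudo: "\<And>e. pseudodiff_op m (\<lambda>f x. LINT y|lborel. G x y * of_real (e \<bullet> (x - y)) * f y)"
    and l: "l \<ge> 1"
  shows "pseudodiff_form_op m l (l - 1) (\<lambda>u x. LINT y|lborel. G x y *s contract (x - y) (u y))"
proof -
  let ?A = "\<lambda>u x. LINT y|lborel. G x y *s contract (x - y) (u y)"
  define L where "L K J f x = (LINT y|lborel. G x y * of_real (contraction_covector K J \<bullet> (x - y)) * f y)"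
    for K J :: "'n set" and f and x :: "real^'n::_"
  \<comment> \<open>The forms \<open>f *s dx J\<close> have the zero function as their other components.\<close>
  have zero: "(\<lambda>x::real^'n::_. 0::complex) \<in> test_functions"
    by (rule test_functionI[of _ 0 0]) (auto intro: smooth_const)
  have A: "?A u x = (\<Sum>K\<in>UNIV. \<Sum>J\<in>UNIV. L K J (\<lambda>y. u y $ J) x *s dx K)"
    if u: "\<And>J. (\<lambda>y. u y $ J) \<in> test_functions" for u x
  proof -
    have bl: "bounded_linear (\<lambda>c. c *s dx K)" for K :: "'n set"
      unfolding linear_conv_bounded_linear[symmetric]
      by (rule linearI) (auto simp: vec_eq_iff axis_def)
    have eq: "G x y *s contract (x - y) (u y) =
        (\<Sum>K\<in>UNIV. \<Sum>J\<in>UNIV. (G x y * of_real (contraction_covector K J \<bullet> (x - y)) * u y $ J) *s dx K)" for y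
    proof (rule vec_eq_iff[THEN iffD2], rule allI)
      fix K
      have "(\<Sum>K'\<in>UNIV. \<Sum>J\<in>UNIV. (G x y * of_real (contraction_covector K' J \<bullet> (x - y)) * u y $ J) *s dx K') $ K =
          (\<Sum>K'\<in>UNIV. if K' = K then (\<Sum>J\<in>UNIV. G x y * of_real (contraction_covector K' J \<bullet> (x - y)) * u y $ J) else 0)"
        unfolding sum_component by (intro sum.cong) (auto simp: axis_def)
      then show "(G x y *s contract (x - y) (u y)) $ K =
          (\<Sum>K'\<in>UNIV. \<Sum>J\<in>UNIV. (G x y * of_real (contraction_covector K' J \<bullet> (x - y)) * u y $ J) *s dx K') $ K"
        by (simp add: contract_nth sum_distrib_left mult.assoc)
    qed
    have "?A u x = (\<Sum>K\<in>UNIV. \<Sum>J\<in>UNIV. LINT y|lborel. (G x y * of_real (contraction_covector K J \<bullet> (x - y)) * u y $ J) *s dx K)"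
      unfolding eq
      by (subst Bochner_Integration.integral_sum, intro Bochner_Integration.integrable_sum integrable_bounded_linear[OF bl] int u,
          rule sum.cong[OF refl],
          subst Bochner_Integration.integral_sum, intro integrable_bounded_linear[OF bl] int u, rule refl)
    also have "\<dots> = (\<Sum>K\<in>UNIV. \<Sum>J\<in>UNIV. L K J (\<lambda>y. u y $ J) x *s dx K)"
      unfolding L_def by (intro sum.cong refl integral_bounded_linear[OF bl] int u)
    finally show ?thesis .
  qed
  have L0: "L K J (\<lambda>y. 0) x = 0" for K J x
    by (simp add: L_def)
  have entry: "matrix_entry ?A K J f x = L K J f x" if f: "f \<in> test_functions" for K J f x
  proof -
    have u: "(\<lambda>y. (f y *s dx J) $ J') = (if J' = J then f else (\<lambda>y. 0))" for J'
      by (auto simp: axis_def fun_eq_iff)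
    have "(\<lambda>y. (f y *s dx J) $ J') \<in> test_functions" for J'
      unfolding u using f zero by simp
    then have "?A (\<lambda>y. f y *s dx J) x = (\<Sum>K\<in>UNIV. \<Sum>J'\<in>UNIV. L K J' (\<lambda>y. (f y *s dx J) $ J') x *s dx K)"
      by (rule A)
    also have "\<dots> = (\<Sum>K\<in>UNIV. \<Sum>J'\<in>UNIV. if J' = J then L K J f x *s dx K else 0)"
      unfolding u by (intro sum.cong) (auto simp: L0)
    also have "\<dots> = (\<Sum>K\<in>UNIV. L K J f x *s dx K)"
      by simp
    also have "\<dots> $ K = (\<Sum>K'\<in>UNIV. if K' = K then L K' J f x else 0)"
      unfolding sum_component by (intro sum.cong) (auto simp: axis_def)
    finally show ?thesis
      by (simp add: matrix_entry_def)
  qed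
  show ?thesis
    unfolding pseudodiff_form_op_def
  proof (intro conjI ballI allI impI)
    fix u :: "real^'n::_ \<Rightarrow> complex^('n set)" and x
    assume "u \<in> test_forms l"
    then have u: "\<And>J. (\<lambda>y. u y $ J) \<in> test_functions" and u0: "\<And>y J. card J \<noteq> l \<Longrightarrow> u y $ J = 0"
      by (auto simp: test_forms_def)
    have "?A u x = (\<Sum>K\<in>UNIV. \<Sum>J\<in>UNIV. L K J (\<lambda>y. u y $ J) x *s dx K)"
      by (rule A[OF u])
    also have "\<dots> = (\<Sum>K\<in>UNIV. \<Sum>J | card J = l. L K J (\<lambda>y. u y $ J) x *s dx K)"
      by (intro sum.cong refl sum.mono_neutral_right) (auto simp: u0 L0)
    also have "\<dots> = (\<Sum>K | card K = l - 1. \<Sum>J | card J = l. L K J (\<lambda>y. u y $ J) x *s dx K)"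
    proof (rule sum.mono_neutral_right, simp, simp, rule ballI, rule sum.neutral, rule ballI)
      fix K J :: "'n set"
      assume "K \<in> UNIV - {K. card K = l - 1}" "J \<in> {J. card J = l}"
      then have "contraction_covector K J = 0"
        using l by (intro contraction_covector_eq_0) auto
      then show "L K J (\<lambda>y. u y $ J) x *s dx K = 0"
        by (simp add: L_def)
    qed
    also have "\<dots> = (\<Sum>K | card K = l - 1. \<Sum>J | card J = l. matrix_entry ?A K J (\<lambda>y. u y $ J) x *s dx K)"
      by (simp add: entry[OF u])
    finally show "?A u x = (\<Sum>K | card K = l - 1. \<Sum>J | card J = l. matrix_entry ?A K J (\<lambda>y. u y $ J) x *s dx K)" .
  next
    fix K J :: "'n set"
    have "pseudodiff_op m (L K J)"
      unfolding L_def by (rule pseudo)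
    then show "pseudodiff_op m (matrix_entry ?A K J)"
      unfolding pseudodiff_op_def by (simp add: entry)
  qed
qed

text \<open>
  Here \<open>t \<ge> 1\<close> is already the parameter of the ray, as \<open>x + t (y - x) = x - t (x - y)\<close>; only the weight
  has to be rewritten as \<open>(t - 1)\<^sup>l\<^sup>-\<^sup>1 t\<^sup>n\<^sup>-\<^sup>l = t\<^sup>n\<^sup>-\<^sup>1 (1 - 1 / t)\<^sup>l\<^sup>-\<^sup>1\<close>.
\<close>

section \<open>The kernels of the two operators\<close>

lemma G_kernel_swap_eq_radial_kernel:
  fixes \<theta> :: "real^'n::{finite,linorder} \<Rightarrow> complex"
  assumes l: "l \<in> {1..CARD('n)}"
  shows "G_kernel \<theta> (CARD('n) - l + 1) y x = radial_kernel (\<lambda>r. of_real ((1 - r) ^ (l - 1))) (- 1) \<theta> x (x - y)"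
proof -
  have pow: "(t - 1) ^ (CARD('n) - (CARD('n) - l + 1)) * t ^ (CARD('n) - l + 1 - 1) =
      t ^ (CARD('n) - 1) * (1 - inverse t) ^ (l - 1)" if "t \<ge> 1" for t :: real
  proof -
    have n: "CARD('n) - (CARD('n) - l + 1) = l - 1" "CARD('n) - 1 = (CARD('n) - l) + (l - 1)"
      using l by auto
    have "t * (1 - inverse t) = t - 1"
      using that by (simp add: field_simps)
    then have "t ^ (l - 1) * (1 - inverse t) ^ (l - 1) = (t - 1) ^ (l - 1)"
      by (simp only: power_mult_distrib[symmetric])
    then show ?thesis
      unfolding n by (simp add: power_add mult_ac)
  qed
  have arg: "x + t *\<^sub>R (y - x) = x + (- 1 * t) *\<^sub>R (x - y)" for t
    by (simp add: algebra_simps)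
  show ?thesis
    unfolding G_kernel_def radial_kernel_def DIM_cart DIM_real mult_1_right
  proof (rule set_lebesgue_integral_cong)
    show "\<forall>t. t \<in> {1..} \<longrightarrow>
        of_real ((t - 1) ^ (CARD('n) - (CARD('n) - l + 1)) * t ^ (CARD('n) - l + 1 - 1)) * \<theta> (x + t *\<^sub>R (y - x)) =
        of_real (t ^ (CARD('n) - 1)) * of_real ((1 - inverse t) ^ (l - 1)) * \<theta> (x + (- 1 * t) *\<^sub>R (x - y))"
      by (intro allI impI, subst pow, simp, subst arg, simp only: of_real_mult)
  qed simp
qed

text \<open>
  The part of the integral for \<open>G_kernel\<close> in which the argument of \<open>\<theta>\<close> runs through the segment from
  \<open>x\<close> to \<open>x + (x - y)\<close>; in contrast to the rest it is smooth on the diagonal.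
\<close>

definition segment_kernel ::
    "(real^'n::{finite,linorder} \<Rightarrow> complex) \<Rightarrow> nat \<Rightarrow> real^'n::{finite,linorder} \<Rightarrow> real^'n::{finite,linorder} \<Rightarrow> complex" where
  "segment_kernel \<theta> l x y =
     integral {0..1} (\<lambda>s. of_real (s ^ (CARD('n) - l) * (1 + s) ^ (l - 1)) * \<theta> (x + s *\<^sub>R (x - y)))"

lemma smooth_segment_kernel:
  assumes \<theta>: "\<theta> \<in> test_functions"
  shows "smooth (\<lambda>(x, y). segment_kernel \<theta> l x y)"
proof -
  have "smooth (\<lambda>z. of_real (snd z ^ (CARD('n) - l) * (1 + snd z) ^ (l - 1)) *
      \<theta> (fst (fst z) + snd z *\<^sub>R (fst (fst z) - snd (fst z))))"
    by (intro smooth_mult smooth_compose[OF test_functionD(1)[OF \<theta>]]) (intro smooth_intros)+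
  from smooth_integral_cbox[OF this, of 0 1] show ?thesis
    by (simp add: segment_kernel_def case_prod_unfold)
qed

text \<open>
  Substitute \<open>s = t - 1\<close>, so that the argument of \<open>\<theta>\<close> becomes \<open>x + s (x - y)\<close>, and split at
  \<open>s = 1\<close>. For \<open>x \<noteq> y\<close> the integrand has compact support; on the diagonal the integral over
  \<open>s \<ge> 1\<close> may diverge.
\<close>

lemma G_kernel_eq_radial_kernel_add_segment_kernel:
  fixes \<theta> :: "real^'n::{finite,linorder} \<Rightarrow> complex"
  assumes l: "l \<in> {1..CARD('n)}" and \<theta>: "\<theta> \<in> test_functions" and xy: "x \<noteq> y"
  shows "G_kernel \<theta> l x y =
    radial_kernel (\<lambda>r. of_real ((1 + r) ^ (l - 1))) 1 \<theta> x (x - y) + segment_kernel \<theta> l x y"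
proof -
  let ?g = "\<lambda>s. of_real (s ^ (CARD('n) - l) * (1 + s) ^ (l - 1)) * \<theta> (x + s *\<^sub>R (x - y))"
  have "smooth ?g"
    by (intro smooth_mult smooth_compose[OF test_functionD(1)[OF \<theta>]]) (intro smooth_intros)+
  obtain a where a: "\<And>t. t \<notin> cbox (- a) a \<Longrightarrow> \<theta> t = 0"
    using test_functionD(2)[OF \<theta>] by blast
  obtain B where B: "\<And>t. t \<in> cbox (- a) a \<Longrightarrow> norm t \<le> B"
    using bounded_cbox[of "- a" a] by (auto simp: bounded_iff)
  \<comment> \<open>For \<open>|s| > ?S\<close> the point \<open>x + s (x - y)\<close> has norm greater than \<open>B\<close>, hence lies outside the support of \<open>\<theta>\<close>.\<close>
  let ?S = "(B + norm x) / norm (x - y)"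
  have "?g s = 0" if "s \<notin> cbox (- ?S) ?S" for s
  proof -
    have "?S < \<bar>s\<bar>"
      using that by (auto simp: abs_le_iff not_le)
    then have "B + norm x < norm (s *\<^sub>R (x - y))"
      using xy by (simp add: pos_divide_less_eq)
    also have "\<dots> \<le> norm (x + s *\<^sub>R (x - y)) + norm x"
      using norm_triangle_ineq4[of "x + s *\<^sub>R (x - y)" x] by simp
    finally have "x + s *\<^sub>R (x - y) \<notin> cbox (- a) a"
      using B[of "x + s *\<^sub>R (x - y)"] by fastforce
    then show ?thesis
      using a by simp
  qed
  then have "?g \<in> test_functions"
    using \<open>smooth ?g\<close> by (rule test_functionI[rotated])
  note gi = test_function_integrable[OF this]
  have [measurable]: "?g \<in> borel_measurable borel"
    using \<open>smooth ?g\<close> by (rule smooth_measurable)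
  have i: "integrable lborel (\<lambda>s. indicator S s *\<^sub>R ?g s)" if "S \<in> sets borel" for S
    using integrable_mult_indicator[OF _ gi, of S] that by simp
  have arg: "y + (1 + s) *\<^sub>R (x - y) = x + s *\<^sub>R (x - y)" for s
    by (simp add: algebra_simps)
  have shift: "(LINT t|lborel. h t) = (LINT s|lborel. h (1 + s))" for h :: "real \<Rightarrow> complex"
    using integral_affine[of 1 h 1] by simp
  have "G_kernel \<theta> l x y = (LINT s|lborel. indicator {0..} s *\<^sub>R ?g s)"
    unfolding G_kernel_def set_lebesgue_integral_def shift[of "\<lambda>t. indicator {1..} t *\<^sub>R _ t"] arg
    by (rule Bochner_Integration.integral_cong) (simp_all add: indicator_def)
  also have "\<dots> = (LINT s|lborel. indicator {1..} s *\<^sub>R ?g s + indicator {0..1} s *\<^sub>R ?g s)"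
  proof (rule integral_cong_AE)
    show "AE s in lborel. indicator {0..} s *\<^sub>R ?g s = indicator {1..} s *\<^sub>R ?g s + indicator {0..1} s *\<^sub>R ?g s"
      using AE_lborel_singleton[of "1::real"] by eventually_elim (auto simp: indicator_def)
  qed measurable
  also have "\<dots> = (LINT s:{1..}|lborel. ?g s) + (LINT s:{0..1}|lborel. ?g s)"
    unfolding set_lebesgue_integral_def by (rule Bochner_Integration.integral_add) (rule i, simp)+
  also have "(LINT s:{1..}|lborel. ?g s) = radial_kernel (\<lambda>r. of_real ((1 + r) ^ (l - 1))) 1 \<theta> x (x - y)"
    unfolding radial_kernel_def DIM_cart DIM_real mult_1_right mult_1_left
  proof (rule set_lebesgue_integral_cong)
    have pow: "t ^ (CARD('n) - l) * (1 + t) ^ (l - 1) = t ^ (CARD('n) - 1) * (1 + inverse t) ^ (l - 1)"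
      if "t \<ge> 1" for t :: real
    proof -
      have n: "CARD('n) - 1 = (CARD('n) - l) + (l - 1)"
        using l by auto
      have "t * (1 + inverse t) = 1 + t"
        using that by (simp add: field_simps)
      then have "t ^ (l - 1) * (1 + inverse t) ^ (l - 1) = (1 + t) ^ (l - 1)"
        by (simp only: power_mult_distrib[symmetric])
      then show ?thesis
        unfolding n by (simp add: power_add mult_ac)
    qed
    show "\<forall>t. t \<in> {1..} \<longrightarrow> ?g t =
        of_real (t ^ (CARD('n) - 1)) * of_real ((1 + inverse t) ^ (l - 1)) * \<theta> (x + t *\<^sub>R (x - y))"
      by (intro allI impI, subst pow, simp, simp only: of_real_mult)
  qed simp
  also have "(LINT s:{0..1}|lborel. ?g s) = segment_kernel \<theta> l x y"
    unfolding segment_kernel_def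
    using set_lebesgue_integral_cbox(2)[OF smooth_continuous_on[OF \<open>smooth ?g\<close>], of 0 1] by simp
  finally show ?thesis .
qed

theorem theorem3p2:
  fixes \<theta> :: "real^'n::{finite,linorder} \<Rightarrow> complex"
    and c :: "real^'n::{finite,linorder}" and r :: real and l :: nat
  assumes "\<theta> \<in> test_functions"
    and "supp \<theta> \<subseteq> ball c r"
    and "(LINT x|lborel. \<theta> x) = 1"
    and "l \<in> {1..CARD('n)}"
  shows "pseudodiff_form_op (-1) l (l - 1) (R_op \<theta> l) \<and>
         pseudodiff_form_op (-1) l (l - 1) (T_op \<theta> l)"
proof
  note \<theta> = assms(1) and l = assms(4)
  have l1: "l \<ge> 1" using l by simp
  let ?pR = "\<lambda>r::real. of_real ((1 - r) ^ (l - 1)) :: complex"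
  let ?pT = "\<lambda>r::real. of_real ((1 + r) ^ (l - 1)) :: complex"
  have pR: "smooth ?pR" and pT: "smooth ?pT"
    by (intro smooth_of_real smooth_power smooth_diff smooth_add smooth_const smooth_id)+
  have "pseudodiff_form_op (- 1) l (l - 1)
      (\<lambda>u x. LINT y|lborel. radial_kernel ?pR (- 1) \<theta> x (x - y) *s contract (x - y) (u y))"
  proof (rule pseudodiff_form_op_contraction[OF _ _ l1])
    show "integrable lborel (\<lambda>y. radial_kernel ?pR (- 1) \<theta> x (x - y) * of_real (e \<bullet> (x - y)) * f y)"
      if "f \<in> test_functions" for e f x
      by (rule radial_kernel_integral(1)[OF pR \<theta> that]) simp
    show "pseudodiff_op (- 1) (\<lambda>f x. LINT y|lborel. radial_kernel ?pR (- 1) \<theta> x (x - y) * of_real (e \<bullet> (x - y)) * f y)"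
      for e
      by (rule pseudodiff_op_radial_kernel[OF pR \<theta>, where k = "\<lambda>x y. 0" and \<sigma> = "- 1" and e = e])
         (auto simp: kernel_op_def case_prod_unfold intro: smooth_const)
  qed
  then show "pseudodiff_form_op (- 1) l (l - 1) (R_op \<theta> l)"
    unfolding R_op_def[abs_def] G_kernel_swap_eq_radial_kernel[OF l] .
  \<comment> \<open>On the diagonal, where the splitting of the kernel may fail, both sides vanish because of the factor
    \<open>\<langle>e, x - y\<rangle>\<close>.\<close>
  have G: "G_kernel \<theta> l x y * of_real (e \<bullet> (x - y)) * z =
      radial_kernel ?pT 1 \<theta> x (x - y) * of_real (e \<bullet> (x - y)) * z +
      of_real (e \<bullet> (x - y)) * segment_kernel \<theta> l x y * z" for e x y z
    by (cases "x = y") (simp_all add: G_kernel_eq_radial_kernel_add_segment_kernel[OF l \<theta>] ring_distribs)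
  have k: "smooth (\<lambda>(x, y). of_real (e \<bullet> (x - y)) * segment_kernel \<theta> l x y)" for e
  proof -
    have "smooth (\<lambda>z. of_real (e \<bullet> (fst z - snd z)) * (\<lambda>(x, y). segment_kernel \<theta> l x y) z)"
      by (rule smooth_mult[OF _ smooth_segment_kernel[OF \<theta>]]) (intro smooth_intros)
    then show ?thesis
      by (simp add: case_prod_unfold)
  qed
  have ri: "integrable lborel (\<lambda>y. radial_kernel ?pT 1 \<theta> x (x - y) * of_real (e \<bullet> (x - y)) * f y)"
    if "f \<in> test_functions" for e f x
    by (rule radial_kernel_integral(1)[OF pT \<theta> that]) simp
  have ki: "integrable lborel (\<lambda>y. of_real (e \<bullet> (x - y)) * segment_kernel \<theta> l x y * f y)"
    if "f \<in> test_functions" for e f x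
    using test_function_integrable[OF test_function_mult[OF smooth_slice(2)[OF k[of e], of x] that]] by simp
  show "pseudodiff_form_op (- 1) l (l - 1) (T_op \<theta> l)"
    unfolding T_op_def[abs_def]
  proof (rule pseudodiff_form_op_contraction[OF _ _ l1])
    show "integrable lborel (\<lambda>y. G_kernel \<theta> l x y * of_real (e \<bullet> (x - y)) * f y)"
      if "f \<in> test_functions" for e f x
      unfolding G by (rule Bochner_Integration.integrable_add[OF ri[OF that] ki[OF that]])
    show "pseudodiff_op (- 1) (\<lambda>f x. LINT y|lborel. G_kernel \<theta> l x y * of_real (e \<bullet> (x - y)) * f y)" for e
    proof (rule pseudodiff_op_radial_kernel[OF pT \<theta> _ k[of e], where \<sigma> = 1 and e = e])
      show "(LINT y|lborel. G_kernel \<theta> l x y * of_real (e \<bullet> (x - y)) * f y) =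
          (LINT y|lborel. radial_kernel ?pT 1 \<theta> x (x - y) * of_real (e \<bullet> (x - y)) * f y) +
          kernel_op (\<lambda>x y. of_real (e \<bullet> (x - y)) * segment_kernel \<theta> l x y) f x"
        if "f \<in> test_functions" for f x
        unfolding G kernel_op_def by (rule Bochner_Integration.integral_add[OF ri[OF that] ki[OF that]])
    qed simp
  qed
qed

end
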